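(* Given $\hat f_h^{\mathfrak n}=X^\top U^{\mathfrak n}S^{\mathfrak n}(E^{\mathfrak n})^\top Y$ with $U^{\mathfrak n}\in\mathbb R^{m\times r}$, $S^{\mathfrak n}\in\mathbb R^{r\times r}$, $E^{\mathfrak n}\in\mathbb R^{n\times r}$, $(U^{\mathfrak n})^\top U^{\mathfrak n}=I_r=(E^{\mathfrak n})^\top A_{\boldsymbol 1}E^{\mathfrak n}$, and any $\Delta t>0$, the scheme $$\Big(\tfrac{f_{\mathbf K}^{\mathfrak n+1}-\hat f_h^{\mathfrak n}}{\Delta t},w_1;\varepsilon^2\Big)_\Omega=\mathcal A(f_{\mathbf K}^{\mathfrak n+1},w_1)\quad\forall w_1\in V_1^{\mathfrak n},$$ $$\Big(\tfrac{f_{\mathbf L}^{\mathfrak n+1}-\hat f_h^{\mathfrak n}}{\Delta t},w_2;\varepsilon^2\Big)_\Omega=\mathcal A(f_{\mathbf L}^{\mathfrak n+1},w_2)\quad\forall w_2\in V_2^{\mathfrak n},$$ $$\Big(\tfrac{f_S^{\mathfrak n+1}-\hat f_h^{\mathfrak n}}{\Delta t},w_0;\varepsilon^2\Big)_\Omega=\mathcal A(f_S^{\mathfrak n+1},w_0)\quad\forall w_0\in V_0^{\mathfrak n+1}$$ admits a unique solution $(f_{\mathbf K}^{\mathfrak n+1},f_{\mathbf L}^{\mathfrak n+1},f_S^{\mathfrak n+1})\in V_1^{\mathfrak n}\times V_2^{\mathfrak n}\times V_0^{\mathfrak n+1}$. Equivalently, the algorithm $$\frac{\mathbf K^{\mathfrak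 n+1}-U^{\mathfrak n}S^{\mathfrak n}}{\Delta t}=G\big(\mathbf K^{\mathfrak n+1}(E^{\mathfrak n})^\top\big)E^{\mathfrak n},\qquad \frac{\mathbf L^{\mathfrak n+1}-E^{\mathfrak n}(S^{\mathfrak n})^\top}{\Delta t}=A_{\boldsymbol 1}^{-1}G\big(U^{\mathfrak n}(\mathbf L^{\mathfrak n+1})^\top\big)^\top U^{\mathfrak n},$$ $$\frac{S^{\mathfrak n+1}-S^{\mathfrak n,*}}{\Delta t}=(U^{\mathfrak n+1})^\top G\big(U^{\mathfrak n+1}S^{\mathfrak n+1}(E^{\mathfrak n+1})^\top\big)E^{\mathfrak n+1},\qquad S^{\mathfrak n,*}=(U^{\mathfrak n+1})^\top U^{\mathfrak n}S^{\mathfrak n}(E^{\mathfrak n})^\top A_{\boldsymbol 1}E^{\mathfrak n+1},$$ admits a unique matrix solution $(\mathbf K^{\mathfrak n+1},\mathbf L^{\mathfrak n+1},S^{\mathfrak n+1})\in\mathbb R^{m\times r}\times\mathbb R^{n\times r}\times\mathbb R^{r\times r}$.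
   Context: Let $\varepsilon_{\max}>0$, $\Omega=\Omega_\mu\times\Omega_\varepsilon$ with $\Omega_\mu=[-1,1]\ni\mu$, $\Omega_\varepsilon=[0,\varepsilon_{\max}]\ni\varepsilon$. The weighted inner product is $(v,w;\varepsilon^2)_\Omega=\int_0^{\varepsilon_{\max}}\int_{-1}^1 vw\,\varepsilon^2\,d\mu\,d\varepsilon$. The emissivity $\eta=\eta(\varepsilon)>0$ (square integrable with respect to $\varepsilon^2d\varepsilon$) and the opacity $\chi=\chi(\varepsilon)$ are given, with constants $0<\chi_{\min}\le\chi\le\chi_{\max}$. Set $\mathcal A(f,w)=(\eta,w;\varepsilon^2)_\Omega-(\chi f,w;\varepsilon^2)_\Omega$. Partition $\Omega_\mu$ and $\Omega_\varepsilon$ into $N_\mu$ and $N_\varepsilon$ intervals; $V_{\mu,h}$, $V_{\varepsilon,h}$ are the spaces of (discontinuous) piecewise polynomials of degree at most $k$ on these partitions, and $V_h=V_{\mu,h}\otimes V_{\varepsilon,h}$. Let $m=(k+1)N_\mu$, $n=(k+1)N_\varepsilon$, $1\le r\le\min\{m,n\}$. Let $\{x_i(\mu)\}_{i=1}^m$, $\{y_j(\varepsilon)\}_{j=1}^n$ be the bases of $V_{\mu,h}$, $V_{\varepsilon,h}$ consisting of Legendre polynomials supported on single cells and orthonormal in the unweighted $L^2$ inner product of the cell; $X(\mu)=[x_1,\dots,x_m]^\top$, $Y(\varepsilon)=[y_1,\dots,y_n]^\top$. $A_{\boldsymbol 1}=[\int_{\Omega_\varepsilon}y_iy_j\varepsilon^2d\varepsilon]$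 and $A_\chi=[\int_{\Omega_\varepsilon}\chi y_iy_j\varepsilon^2d\varepsilon]$ are symmetric positive definite $n\times n$ matrices. $L_0=[\int_{-1}^1x_i\,d\mu]_i\in\mathbb R^{m\times1}$, $L_\eta=[\int_{\Omega_\varepsilon}\eta y_j\varepsilon^2d\varepsilon]_j\in\mathbb R^{n\times1}$, and $G(F)=L_0L_\eta^\top-FA_\chi$ for $F\in\mathbb R^{m\times n}$. $V_1^{\mathfrak n}=\{X^\top\mathbf K(E^{\mathfrak n})^\top Y:\mathbf K\in\mathbb R^{m\times r}\}$, $V_2^{\mathfrak n}=\{X^\top U^{\mathfrak n}\mathbf L^\top Y:\mathbf L\in\mathbb R^{n\times r}\}$. After $\mathbf K^{\mathfrak n+1}$ and $\mathbf L^{\mathfrak n+1}$ (equivalently $f_{\mathbf K}^{\mathfrak n+1}=X^\top\mathbf K^{\mathfrak n+1}(E^{\mathfrak n})^\top Y$ and $f_{\mathbf L}^{\mathfrak n+1}=X^\top U^{\mathfrak n}(\mathbf L^{\mathfrak n+1})^\top Y$) are determined, one takes a QR factorization $\mathbf K^{\mathfrak n+1}=U^{\mathfrak n+1}R_{\mathbf K}$, $(U^{\mathfrak n+1})^\top U^{\mathfrak n+1}=I_r$, and a generalized QR factorization $\mathbf L^{\mathfrak n+1}=E^{\mathfrak n+1}R_{\mathbf L}$, $(E^{\mathfrak n+1})^\top A_{\boldsymbol 1}E^{\mathfrak n+1}=I_r$ ($R_{\mathbf K},R_{\mathbf L}\in\mathbb R^{r\times r}$), by any fixed choice, and sets $V_0^{\mathfrak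 n+1}=\{X^\top U^{\mathfrak n+1}S(E^{\mathfrak n+1})^\top Y:S\in\mathbb R^{r\times r}\}$; uniqueness of $S^{\mathfrak n+1}$ and $f_S^{\mathfrak n+1}$ is for that choice of $U^{\mathfrak n+1},E^{\mathfrak n+1}$. *)

theory Defs
  imports
    "HOL-Analysis.Analysis"
    "HOL-Computational_Algebra.Polynomial"
    "Jordan_Normal_Form.Matrix"
    "Jordan_Normal_Form.Gauss_Jordan_Elimination"
begin

hide_const (open) Finite_Cartesian_Product.mat Finite_Cartesian_Product.vec
hide_type (open) Finite_Cartesian_Product.vec

section \<open>Discontinuous piecewise polynomials and cellwise Legendre bases\<close>

definition interval_partition :: "real \<Rightarrow> real \<Rightarrow> nat \<Rightarrow> (nat \<Rightarrow> real) \<Rightarrow> bool" where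
  "interval_partition a b N p \<longleftrightarrow> p 0 = a \<and> p N = b \<and> (\<forall>j<N. p j < p (Suc j))"

text \<open>Cells are half-open, the last one closed, so that they partition the interval and a
  discontinuous piecewise polynomial is an honest single-valued function.\<close>

definition cell :: "(nat \<Rightarrow> real) \<Rightarrow> nat \<Rightarrow> nat \<Rightarrow> real set" where
  "cell p N j = (if Suc j = N then {p j..p (Suc j)} else {p j..<p (Suc j)})"

text \<open>Functions are extended by zero outside the interval, so that equality of functions
  is equality on the interval.\<close>

definition pw_poly_space :: "(nat \<Rightarrow> real) \<Rightarrow> nat \<Rightarrow> nat \<Rightarrow> (real \<Rightarrow> real) set" where
  "pw_poly_space p N k = {v.
     (\<forall>j<N. \<exists>q::real poly. degree q \<le> k \<and> (\<forall>t\<in>cell p N j. v t = poly q t)) \<and>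
     (\<forall>t. t \<notin> {p 0..p N} \<longrightarrow> v t = 0)}"

definition is_basis :: "(real \<Rightarrow> real) set \<Rightarrow> nat \<Rightarrow> (nat \<Rightarrow> real \<Rightarrow> real) \<Rightarrow> bool" where
  "is_basis V d x \<longleftrightarrow>
     V = {\<lambda>t. \<Sum>i<d. c i * x i t | c. True} \<and>
     (\<forall>c. (\<forall>t. (\<Sum>i<d. c i * x i t) = 0) \<longrightarrow> (\<forall>i<d. c i = 0))"

fun legendre :: "nat \<Rightarrow> real poly" where
  "legendre 0 = 1"
| "legendre (Suc 0) = [:0, 1:]"
| "legendre (Suc (Suc l)) =
     Polynomial.smult (1 / real (l + 2))
       (Polynomial.smult (real (2 * l + 3)) ([:0, 1:] * legendre (Suc l)) - Polynomial.smult (real (l + 1)) (legendre l))"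

text \<open>The numbering of the basis functions and their signs are left arbitrary. Orthonormality
  determines the factor \<open>c\<close> up to sign.\<close>

definition legendre_basis ::
  "(nat \<Rightarrow> real) \<Rightarrow> nat \<Rightarrow> nat \<Rightarrow> (nat \<Rightarrow> real \<Rightarrow> real) \<Rightarrow> bool" where
  "legendre_basis p N k x \<longleftrightarrow>
     is_basis (pw_poly_space p N k) ((k + 1) * N) x \<and>
     (\<forall>i<(k + 1) * N. \<exists>j<N. \<exists>l\<le>k. \<exists>c. \<forall>t.
        x i t = (if t \<in> cell p N j
                 then c * poly (legendre l) ((2 * t - p j - p (Suc j)) / (p (Suc j) - p j))
                 else 0)) \<and>
     (\<forall>i<(k + 1) * N. \<forall>j<(k + 1) * N.
        (LINT t:{p 0..p N}|lebesgue. x i t * x j t) = (if i = j then 1 else 0))"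

section \<open>Weighted forms and matrices\<close>

text \<open>Functions on the phase space take the angle \<open>\<mu>\<close> first and the energy \<open>\<epsilon>\<close> second.\<close>

definition weighted_inner ::
  "real \<Rightarrow> (real \<Rightarrow> real \<Rightarrow> real) \<Rightarrow> (real \<Rightarrow> real \<Rightarrow> real) \<Rightarrow> real" where
  "weighted_inner \<epsilon>max v w =
     (LINT \<epsilon>:{0..\<epsilon>max}|lebesgue. (LINT \<mu>:{-1..1}|lebesgue. v \<mu> \<epsilon> * w \<mu> \<epsilon> * \<epsilon>\<^sup>2))"

definition collision_form ::
  "real \<Rightarrow> (real \<Rightarrow> real) \<Rightarrow> (real \<Rightarrow> real) \<Rightarrow>
   (real \<Rightarrow> real \<Rightarrow> real) \<Rightarrow> (real \<Rightarrow> real \<Rightarrow> real) \<Rightarrow> real" where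
  "collision_form \<epsilon>max \<eta> chi f w =
     weighted_inner \<epsilon>max (\<lambda>\<mu> \<epsilon>. \<eta> \<epsilon>) w - weighted_inner \<epsilon>max (\<lambda>\<mu> \<epsilon>. chi \<epsilon> * f \<mu> \<epsilon>) w"

text \<open>\<open>mass_mat\<close> with \<open>\<rho> = 1\<close> and with \<open>\<rho> = chi\<close> gives the two energy matrices of the scheme.\<close>

definition mass_mat :: "real \<Rightarrow> (real \<Rightarrow> real) \<Rightarrow> nat \<Rightarrow> (nat \<Rightarrow> real \<Rightarrow> real) \<Rightarrow> real mat" where
  "mass_mat \<epsilon>max \<rho> n y =
     mat n n (\<lambda>(i, j). LINT \<epsilon>:{0..\<epsilon>max}|lebesgue. \<rho> \<epsilon> * y i \<epsilon> * y j \<epsilon> * \<epsilon>\<^sup>2)"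

definition L0_mat :: "nat \<Rightarrow> (nat \<Rightarrow> real \<Rightarrow> real) \<Rightarrow> real mat" where
  "L0_mat m x = mat m 1 (\<lambda>(i, j). LINT \<mu>:{-1..1}|lebesgue. x i \<mu>)"

definition Leta_mat :: "real \<Rightarrow> (real \<Rightarrow> real) \<Rightarrow> nat \<Rightarrow> (nat \<Rightarrow> real \<Rightarrow> real) \<Rightarrow> real mat" where
  "Leta_mat \<epsilon>max \<eta> n y = mat n 1 (\<lambda>(i, j). LINT \<epsilon>:{0..\<epsilon>max}|lebesgue. \<eta> \<epsilon> * y i \<epsilon> * \<epsilon>\<^sup>2)"

definition G_mat ::
  "real \<Rightarrow> (real \<Rightarrow> real) \<Rightarrow> (real \<Rightarrow> real) \<Rightarrow> nat \<Rightarrow> nat \<Rightarrow>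
   (nat \<Rightarrow> real \<Rightarrow> real) \<Rightarrow> (nat \<Rightarrow> real \<Rightarrow> real) \<Rightarrow> real mat \<Rightarrow> real mat" where
  "G_mat \<epsilon>max \<eta> chi m n x y F =
     L0_mat m x * (Leta_mat \<epsilon>max \<eta> n y)\<^sup>T - F * mass_mat \<epsilon>max chi n y"

section \<open>The weak scheme and the matrix algorithm\<close>

text \<open>The function \<open>X\<^sup>T M Y\<close>.\<close>

definition mat_fun ::
  "(nat \<Rightarrow> real \<Rightarrow> real) \<Rightarrow> (nat \<Rightarrow> real \<Rightarrow> real) \<Rightarrow> real mat \<Rightarrow> real \<Rightarrow> real \<Rightarrow> real" where
  "mat_fun x y M \<mu> \<epsilon> = (\<Sum>i<dim_row M. \<Sum>j<dim_col M. x i \<mu> * M $$ (i, j) * y j \<epsilon>)"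

definition V1_space ::
  "(nat \<Rightarrow> real \<Rightarrow> real) \<Rightarrow> (nat \<Rightarrow> real \<Rightarrow> real) \<Rightarrow> nat \<Rightarrow> nat \<Rightarrow> real mat \<Rightarrow>
   (real \<Rightarrow> real \<Rightarrow> real) set" where
  "V1_space x y m r E = {mat_fun x y (K * E\<^sup>T) | K. K \<in> carrier_mat m r}"

definition V2_space ::
  "(nat \<Rightarrow> real \<Rightarrow> real) \<Rightarrow> (nat \<Rightarrow> real \<Rightarrow> real) \<Rightarrow> nat \<Rightarrow> nat \<Rightarrow> real mat \<Rightarrow>
   (real \<Rightarrow> real \<Rightarrow> real) set" where
  "V2_space x y n r U = {mat_fun x y (U * L\<^sup>T) | L. L \<in> carrier_mat n r}"

definition V0_space ::
  "(nat \<Rightarrow> real \<Rightarrow> real) \<Rightarrow> (nat \<Rightarrow> real \<Rightarrow> real) \<Rightarrow> nat \<Rightarrow> real mat \<Rightarrow> real mat \<Rightarrow>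
   (real \<Rightarrow> real \<Rightarrow> real) set" where
  "V0_space x y r U E = {mat_fun x y (U * S * E\<^sup>T) | S. S \<in> carrier_mat r r}"

text \<open>\<open>Q\<close> is the orthonormal factor of a generalized QR factorization \<open>K = Q R\<close> of a
  \<open>d \<times> r\<close> matrix, orthonormality being with respect to \<open>A\<close>. Triangularity of \<open>R\<close> is not
  required.\<close>

definition qr_factor :: "real mat \<Rightarrow> nat \<Rightarrow> nat \<Rightarrow> real mat \<Rightarrow> real mat \<Rightarrow> bool" where
  "qr_factor A d r K Q \<longleftrightarrow>
     Q \<in> carrier_mat d r \<and> Q\<^sup>T * A * Q = 1\<^sub>m r \<and> (\<exists>R\<in>carrier_mat r r. K = Q * R)"

definition galerkin_solution ::
  "real \<Rightarrow> (real \<Rightarrow> real) \<Rightarrow> (real \<Rightarrow> real) \<Rightarrow> real \<Rightarrow> (real \<Rightarrow> real \<Rightarrow> real) \<Rightarrow>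
   (real \<Rightarrow> real \<Rightarrow> real) set \<Rightarrow> (real \<Rightarrow> real \<Rightarrow> real) \<Rightarrow> bool" where
  "galerkin_solution \<epsilon>max \<eta> chi dt fhat V f \<longleftrightarrow>
     f \<in> V \<and>
     (\<forall>w\<in>V. weighted_inner \<epsilon>max (\<lambda>\<mu> \<epsilon>. (f \<mu> \<epsilon> - fhat \<mu> \<epsilon>) / dt) w
             = collision_form \<epsilon>max \<eta> chi f w)"

text \<open>\<open>QU\<close> and \<open>QE\<close> are the chosen QR procedures, returning the orthonormal factors of the
  matrices \<open>K\<close> and \<open>L\<close> that represent \<open>fK\<close> and \<open>fL\<close>. The space for \<open>fS\<close>
  thus depends on the other two unknowns.\<close>

definition scheme_solution ::
  "real \<Rightarrow> (real \<Rightarrow> real) \<Rightarrow> (real \<Rightarrow> real) \<Rightarrow> nat \<Rightarrow> nat \<Rightarrow> nat \<Rightarrow>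
   (nat \<Rightarrow> real \<Rightarrow> real) \<Rightarrow> (nat \<Rightarrow> real \<Rightarrow> real) \<Rightarrow>
   (real mat \<Rightarrow> real mat) \<Rightarrow> (real mat \<Rightarrow> real mat) \<Rightarrow> real \<Rightarrow>
   real mat \<Rightarrow> real mat \<Rightarrow> real mat \<Rightarrow>
   (real \<Rightarrow> real \<Rightarrow> real) \<Rightarrow> (real \<Rightarrow> real \<Rightarrow> real) \<Rightarrow> (real \<Rightarrow> real \<Rightarrow> real) \<Rightarrow> bool" where
  "scheme_solution \<epsilon>max \<eta> chi m n r x y QU QE dt U S E fK fL fS \<longleftrightarrow>
     (let fhat = mat_fun x y (U * S * E\<^sup>T) in
        galerkin_solution \<epsilon>max \<eta> chi dt fhat (V1_space x y m r E) fK \<and>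
        galerkin_solution \<epsilon>max \<eta> chi dt fhat (V2_space x y n r U) fL \<and>
        (\<exists>K\<in>carrier_mat m r. \<exists>L\<in>carrier_mat n r.
           fK = mat_fun x y (K * E\<^sup>T) \<and> fL = mat_fun x y (U * L\<^sup>T) \<and>
           galerkin_solution \<epsilon>max \<eta> chi dt fhat (V0_space x y r (QU K) (QE L)) fS))"

definition algorithm_solution ::
  "real \<Rightarrow> (real \<Rightarrow> real) \<Rightarrow> (real \<Rightarrow> real) \<Rightarrow> nat \<Rightarrow> nat \<Rightarrow> nat \<Rightarrow>
   (nat \<Rightarrow> real \<Rightarrow> real) \<Rightarrow> (nat \<Rightarrow> real \<Rightarrow> real) \<Rightarrow>
   (real mat \<Rightarrow> real mat) \<Rightarrow> (real mat \<Rightarrow> real mat) \<Rightarrow> real \<Rightarrow>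
   real mat \<Rightarrow> real mat \<Rightarrow> real mat \<Rightarrow> real mat \<Rightarrow> real mat \<Rightarrow> real mat \<Rightarrow> bool" where
  "algorithm_solution \<epsilon>max \<eta> chi m n r x y QU QE dt U S E K1 L1 S1 \<longleftrightarrow>
     (let A1 = mass_mat \<epsilon>max (\<lambda>_. 1) n y;
          G = G_mat \<epsilon>max \<eta> chi m n x y;
          U1 = QU K1;
          E1 = QE L1;
          Sstar = U1\<^sup>T * U * S * E\<^sup>T * A1 * E1
      in K1 \<in> carrier_mat m r \<and> L1 \<in> carrier_mat n r \<and> S1 \<in> carrier_mat r r \<and>
         (1 / dt) \<cdot>\<^sub>m (K1 - U * S) = G (K1 * E\<^sup>T) * E \<and>
         (1 / dt) \<cdot>\<^sub>m (L1 - E * S\<^sup>T) = the (mat_inverse A1) * (G (U * L1\<^sup>T))\<^sup>T * U \<and>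
         (1 / dt) \<cdot>\<^sub>m (S1 - Sstar) = U1\<^sup>T * G (U1 * S1 * E1\<^sup>T) * E1)"

end

theory Submission
  imports Defs "Jordan_Normal_Form.Determinant"
begin

text \<open>
  All three problems of the scheme are one problem. For matrices \<open>P\<close> and \<open>Q\<close> the trial space is
  \<open>{X\<^sup>T P M Q\<^sup>T Y | M}\<close>: the first space has \<open>P = I\<close>, \<open>Q = E\<close>, the second has \<open>P = U\<close>, \<open>Q = I\<close>
  and \<open>M = L\<^sup>T\<close>, and the last one has the two new orthonormal factors. In each case \<open>P\<^sup>T P = I\<close> and
  \<open>Q\<close> has a left inverse.

  Since the angular basis is orthonormal, the weighted form of \<open>X\<^sup>T F Y\<close> and \<open>X\<^sup>T W Y\<close> with a weight
  \<open>\<rho>(\<epsilon>)\<close> is the Frobenius product of \<open>F A\<^sub>\<rho>\<close> and \<open>W\<close>, where \<open>A\<^sub>\<rho>\<close> is the energy mass matrix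
  (\<open>weighted_inner_mat_fun\<close>), and the emission term is the Frobenius product of \<open>L\<^sub>0 L\<^sub>\<eta>\<^sup>T\<close> and \<open>W\<close>
  (\<open>weighted_inner_emission\<close>). Testing with all \<open>W = P M Q\<^sup>T\<close> turns the weak equation into the matrix
  equation \<open>P\<^sup>T (F - F\<^sub>0) A\<^sub>1 Q / \<Delta>t = P\<^sup>T G(F) Q\<close> (\<open>galerkin_iff_projected_step\<close>). For the three
  choices of \<open>P\<close> and \<open>Q\<close> this is, after using the orthonormality of the factors, the corresponding
  equation of the matrix algorithm; for the second one it has to be transposed and multiplied by the
  inverse of \<open>A\<^sub>1\<close>.

  With \<open>F = P M Q\<^sup>T\<close> the matrix equation is linear, \<open>M B = R\<close> with
  \<open>B = Q\<^sup>T (A\<^sub>1 + \<Delta>t A\<^sub>\<chi>) Q\<close> (\<open>projected_step_linear\<close>). The inner matrix is the mass matrix of the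
  positive weight \<open>1 + \<Delta>t \<chi>\<close>, hence positive definite (\<open>mass_mat_definite\<close>), and injectivity of
  \<open>Q\<close> makes \<open>B\<close> invertible (\<open>definite_sandwich\<close>). So \<open>M\<close> exists and is unique, for every
  \<open>\<Delta>t > 0\<close>.

  The third space is built from the representing matrices \<open>K\<close> and \<open>L\<close> of the first two unknowns.
  These matrices are determined by the functions, because the weak equation for the function already
  forces the matrix to solve its uniquely solvable equation.
\<close>

(* The notation \<open>$\<close> is kept for the components of vectors of variable dimension. *)
unbundle no vec_syntax

section \<open>Matrix equations tested in the Frobenius product\<close>

definition frob :: "real mat \<Rightarrow> real mat \<Rightarrow> real" where
  "frob A B = (\<Sum>i<dim_row B. \<Sum>j<dim_col B. A $$ (i, j) * B $$ (i, j))"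

lemma frob_mult_left:
  assumes A: "A \<in> carrier_mat m n" and P: "P \<in> carrier_mat m a" and M: "M \<in> carrier_mat a n"
  shows "frob A (P * M) = frob (P\<^sup>T * A) M"
proof -
  have "frob A (P * M) = (\<Sum>i<m. \<Sum>j<n. \<Sum>l<a. A $$ (i, j) * P $$ (i, l) * M $$ (l, j))"
    using A P M by (auto simp: frob_def scalar_prod_def sum_distrib_left atLeast0LessThan mult_ac
        intro!: sum.cong)
  also have "\<dots> = (\<Sum>l<a. \<Sum>j<n. \<Sum>i<m. A $$ (i, j) * P $$ (i, l) * M $$ (l, j))"
    by (subst sum.swap, subst (2) sum.swap, subst sum.swap, rule refl)
  also have "\<dots> = frob (P\<^sup>T * A) M"
    using A P M by (auto simp: frob_def scalar_prod_def sum_distrib_left atLeast0LessThan mult_ac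
        intro!: sum.cong)
  finally show ?thesis .
qed

lemma frob_transpose: "A \<in> carrier_mat m n \<Longrightarrow> B \<in> carrier_mat m n \<Longrightarrow> frob A\<^sup>T B\<^sup>T = frob A B"
  unfolding frob_def by (subst sum.swap) (auto intro!: sum.cong)

lemma frob_mult_right:
  assumes A: "A \<in> carrier_mat m n" and Q: "Q \<in> carrier_mat n b" and M: "M \<in> carrier_mat m b"
  shows "frob A (M * Q\<^sup>T) = frob (A * Q) M"
proof -
  have "frob A (M * Q\<^sup>T) = frob A\<^sup>T (M * Q\<^sup>T)\<^sup>T"
    using assms by (intro frob_transpose[symmetric]) auto
  also have "(M * Q\<^sup>T)\<^sup>T = Q * M\<^sup>T"
    using Q M by (subst transpose_mult) auto
  also have "frob A\<^sup>T (Q * M\<^sup>T) = frob (Q\<^sup>T * A\<^sup>T) M\<^sup>T"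
    using assms by (intro frob_mult_left) auto
  also have "Q\<^sup>T * A\<^sup>T = (A * Q)\<^sup>T"
    using A Q by (subst transpose_mult) auto
  also have "frob (A * Q)\<^sup>T M\<^sup>T = frob (A * Q) M"
    using assms by (intro frob_transpose) auto
  finally show ?thesis .
qed

lemma frob_diff:
  assumes "A \<in> carrier_mat m n" "B \<in> carrier_mat m n" "W \<in> carrier_mat m n"
  shows "frob (A - B) W = frob A W - frob B W"
  using assms by (auto simp: frob_def algebra_simps sum_subtractf)

lemma frob_eq_iff:
  assumes A: "A \<in> carrier_mat m n" and B: "B \<in> carrier_mat m n"
  shows "(\<forall>W\<in>carrier_mat m n. frob A W = frob B W) \<longleftrightarrow> A = B"
proof
  assume eq: "\<forall>W\<in>carrier_mat m n. frob A W = frob B W"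
  define D where "D = A - B"
  have D: "D \<in> carrier_mat m n" using A B unfolding D_def by (intro minus_carrier_mat)
  \<comment> \<open>Testing with the difference itself gives the sum of the squares of its entries.\<close>
  have "frob D D = 0"
    using eq D frob_diff[OF A B D] by (simp add: D_def)
  then have "(\<Sum>i<m. \<Sum>j<n. D $$ (i, j) * D $$ (i, j)) = 0"
    using D by (simp add: frob_def)
  then have "\<forall>i\<in>{..<m}. (\<Sum>j<n. D $$ (i, j) * D $$ (i, j)) = 0"
    by (subst (asm) sum_nonneg_eq_0_iff) (auto intro: sum_nonneg)
  then have "\<forall>i\<in>{..<m}. \<forall>j\<in>{..<n}. D $$ (i, j) * D $$ (i, j) = 0"
    by (subst (asm) sum_nonneg_eq_0_iff) auto
  then show "A = B"
    using A B by (intro eq_matI) (auto simp: D_def)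
qed simp

text \<open>The matrix form of Galerkin testing: the adjoint of \<open>M \<mapsto> P M Q\<^sup>T\<close> is \<open>A \<mapsto> P\<^sup>T A Q\<close>, and the
  Frobenius product is nondegenerate.\<close>

lemma frob_test_sandwich:
  assumes A: "A \<in> carrier_mat m n" and B: "B \<in> carrier_mat m n"
    and P: "P \<in> carrier_mat m a" and Q: "Q \<in> carrier_mat n b"
  shows "(\<forall>M\<in>carrier_mat a b. frob A (P * M * Q\<^sup>T) = frob B (P * M * Q\<^sup>T))
    \<longleftrightarrow> P\<^sup>T * A * Q = P\<^sup>T * B * Q"
proof -
  have shift: "frob C (P * M * Q\<^sup>T) = frob (P\<^sup>T * C * Q) M"
    if C: "C \<in> carrier_mat m n" and M: "M \<in> carrier_mat a b" for C M
  proof -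
    have "frob C (P * M * Q\<^sup>T) = frob (C * Q) (P * M)"
      using P Q C M by (intro frob_mult_right[of _ m n _ b]) auto
    also have "\<dots> = frob (P\<^sup>T * (C * Q)) M"
      using P Q C M by (intro frob_mult_left) auto
    also have "P\<^sup>T * (C * Q) = P\<^sup>T * C * Q"
      using P Q C by simp
    finally show ?thesis .
  qed
  have "P\<^sup>T * A * Q \<in> carrier_mat a b" "P\<^sup>T * B * Q \<in> carrier_mat a b"
    using A B P Q by auto
  from frob_eq_iff[OF this] show ?thesis
    using shift[OF A] shift[OF B] by simp
qed

text \<open>If \<open>B v = 0\<close> for \<open>B = Q\<^sup>T A Q\<close>, then \<open>Q v \<bullet> A (Q v) = v \<bullet> B v = 0\<close>, so \<open>Q v = 0\<close> by definiteness
  of \<open>A\<close>, and the left inverse \<open>Z\<close> of \<open>Q\<close> gives \<open>v = 0\<close>. A square matrix with trivial kernel is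
  invertible.\<close>

lemma definite_sandwich:
  fixes A :: "real mat"
  assumes A: "A \<in> carrier_mat n n"
    and def: "\<And>v. v \<in> carrier_vec n \<Longrightarrow> v \<bullet> (A *\<^sub>v v) = 0 \<Longrightarrow> v = 0\<^sub>v n"
    and Q: "Q \<in> carrier_mat n b" and Z: "Z \<in> carrier_mat b n" and ZQ: "Z * Q = 1\<^sub>m b"
  shows "\<exists>B'\<in>carrier_mat b b. (Q\<^sup>T * A * Q) * B' = 1\<^sub>m b \<and> B' * (Q\<^sup>T * A * Q) = 1\<^sub>m b"
proof -
  let ?B = "Q\<^sup>T * A * Q"
  have B: "?B \<in> carrier_mat b b" using A Q by auto
  have "v = 0\<^sub>v b" if v: "v \<in> carrier_vec b" and null: "?B *\<^sub>v v = 0\<^sub>v b" for v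
  proof -
    have Qv: "Q *\<^sub>v v \<in> carrier_vec n" using Q v by auto
    have AQv: "A *\<^sub>v (Q *\<^sub>v v) \<in> carrier_vec n" using A Qv by auto
    have QA: "Q\<^sup>T * A \<in> carrier_mat b n" using A Q by auto
    have "?B *\<^sub>v v = Q\<^sup>T *\<^sub>v (A *\<^sub>v (Q *\<^sub>v v))"
      using assoc_mult_mat_vec[OF QA Q v] assoc_mult_mat_vec[of "Q\<^sup>T" b n A n, OF _ A Qv] Q by simp
    then have "Q\<^sup>T *\<^sub>v (A *\<^sub>v (Q *\<^sub>v v)) = 0\<^sub>v b" using null by simp
    then have "(A *\<^sub>v (Q *\<^sub>v v)) \<bullet> (Q *\<^sub>v v) = 0"
      using transpose_vec_mult_scalar[OF Q v AQv] v by simp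
    then have "(Q *\<^sub>v v) \<bullet> (A *\<^sub>v (Q *\<^sub>v v)) = 0"
      by (simp only: comm_scalar_prod[OF Qv AQv])
    then have "Q *\<^sub>v v = 0\<^sub>v n" by (rule def[OF Qv])
    then have "Z *\<^sub>v (Q *\<^sub>v v) = 0\<^sub>v b" using Z by auto
    then show "v = 0\<^sub>v b"
      using assoc_mult_mat_vec[OF Z Q v] ZQ v by simp
  qed
  then have "det ?B \<noteq> 0"
    using det_0_iff_vec_prod_zero[OF B] by auto
  from det_non_zero_imp_unit[OF B this] show ?thesis
    unfolding Units_def ring_mat_def by auto
qed

lemma unique_right_division:
  fixes B :: "'a :: comm_ring_1 mat"
  assumes B: "B \<in> carrier_mat b b" and B': "B' \<in> carrier_mat b b" "B * B' = 1\<^sub>m b" "B' * B = 1\<^sub>m b"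
    and R: "R \<in> carrier_mat a b"
  shows "\<exists>!M. M \<in> carrier_mat a b \<and> M * B = R"
proof (rule ex1I)
  show "R * B' \<in> carrier_mat a b \<and> R * B' * B = R"
    using assms by (simp add: assoc_mult_mat[OF R B'(1) B])
next
  fix M assume "M \<in> carrier_mat a b \<and> M * B = R"
  then have M: "M \<in> carrier_mat a b" and "M * B = R" by auto
  then have "M * B * B' = R * B'" by simp
  then show "M = R * B'"
    using M B B' by (simp add: assoc_mult_mat[OF M B B'(1)])
qed

section \<open>Integrals against bounded orthonormal functions\<close>

lemma set_integrable_sum:
  fixes f :: "'i \<Rightarrow> 'a \<Rightarrow> real"
  assumes "\<And>i. i \<in> I \<Longrightarrow> set_integrable M A (f i)"
  shows "set_integrable M A (\<lambda>t. \<Sum>i\<in>I. f i t)"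
  using assms unfolding set_integrable_def scaleR_sum_right
  by (intro Bochner_Integration.integrable_sum) auto

lemma set_integral_sum:
  fixes f :: "'i \<Rightarrow> 'a \<Rightarrow> real"
  assumes "\<And>i. i \<in> I \<Longrightarrow> set_integrable M A (f i)"
  shows "(LINT t:A|M. (\<Sum>i\<in>I. f i t)) = (\<Sum>i\<in>I. LINT t:A|M. f i t)"
  using assms unfolding set_integrable_def set_lebesgue_integral_def scaleR_sum_right
  by (intro Bochner_Integration.integral_sum) auto

lemma set_integral_double_sum:
  fixes f :: "'i \<Rightarrow> 'j \<Rightarrow> 'a \<Rightarrow> real"
  assumes "\<And>i j. i \<in> I \<Longrightarrow> j \<in> J \<Longrightarrow> set_integrable M A (f i j)"
  shows "(LINT t:A|M. (\<Sum>i\<in>I. \<Sum>j\<in>J. c i j * f i j t))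
    = (\<Sum>i\<in>I. \<Sum>j\<in>J. c i j * (LINT t:A|M. f i j t))"
proof -
  have "(LINT t:A|M. (\<Sum>i\<in>I. \<Sum>j\<in>J. c i j * f i j t))
      = (\<Sum>i\<in>I. LINT t:A|M. (\<Sum>j\<in>J. c i j * f i j t))"
    using assms by (intro set_integral_sum set_integrable_sum set_integrable_mult_right)
  also have "\<dots> = (\<Sum>i\<in>I. \<Sum>j\<in>J. LINT t:A|M. c i j * f i j t)"
    using assms by (intro sum.cong refl set_integral_sum set_integrable_mult_right)
  finally show ?thesis by simp
qed

lemma set_borel_measurable_times:
  fixes f g :: "'a \<Rightarrow> real"
  assumes "set_borel_measurable M A f" "set_borel_measurable M A g"
  shows "set_borel_measurable M A (\<lambda>t. f t * g t)"
proof -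
  have "(\<lambda>t. (indicator A t *\<^sub>R f t) * (indicator A t *\<^sub>R g t)) \<in> borel_measurable M"
    using assms unfolding set_borel_measurable_def by (intro borel_measurable_times) auto
  also have "(\<lambda>t. (indicator A t *\<^sub>R f t) * (indicator A t *\<^sub>R g t))
      = (\<lambda>t. indicator A t *\<^sub>R (f t * g t))"
    by (auto simp: indicator_def)
  finally show ?thesis
    unfolding set_borel_measurable_def .
qed

lemma set_integrable_mult_bounded:
  fixes f g :: "'a \<Rightarrow> real"
  assumes f: "set_integrable M A f"
    and g: "set_borel_measurable M A g" and C: "\<And>t. t \<in> A \<Longrightarrow> \<bar>g t\<bar> \<le> C"
  shows "set_integrable M A (\<lambda>t. f t * g t)"
proof (rule set_integrable_bound)
  show "set_integrable M A (\<lambda>t. f t * C)"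
    using f by simp
  show "set_borel_measurable M A (\<lambda>t. f t * g t)"
    using f g by (intro set_borel_measurable_times)
      (auto simp: set_integrable_def set_borel_measurable_def)
  show "AE t in M. t \<in> A \<longrightarrow> norm (f t * g t) \<le> norm (f t * C)"
    using C by (intro AE_I2) (force simp: abs_mult intro!: mult_left_mono)
qed

lemma set_integrable_Icc_one: "set_integrable lebesgue {a..b :: real} (\<lambda>_. 1 :: real)"
  by (simp add: set_integrable_def integrable_indicator_iff emeasure_lborel_Icc_eq)

lemma set_integrable_Icc_bounded:
  fixes g :: "real \<Rightarrow> real"
  assumes "set_borel_measurable lebesgue {a..b} g" "\<And>t. t \<in> {a..b} \<Longrightarrow> \<bar>g t\<bar> \<le> C"
  shows "set_integrable lebesgue {a..b} g"
proof -
  have "set_integrable lebesgue {a..b} (\<lambda>_. 1 :: real)"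
    by (rule set_integrable_Icc_one)
  from set_integrable_mult_bounded[OF this assms] show ?thesis by simp
qed

lemma set_borel_measurable_Icc:
  fixes f :: "real \<Rightarrow> real"
  assumes "f \<in> borel_measurable lebesgue"
  shows "set_borel_measurable lebesgue {a..b} f"
  using assms unfolding set_borel_measurable_def
  by (intro borel_measurable_scaleR borel_measurable_indicator) auto

lemma square_borel_lebesgue: "(\<lambda>t::real. t\<^sup>2) \<in> borel_measurable lebesgue"
  by (intro measurable_completion) auto

text \<open>The orthonormality refers to \<open>{a..b}\<close>. Boundedness and measurability are stated on the whole line,
  so that multiplication by \<open>x i\<close> preserves integrability on every interval.\<close>

definition bounded_orthonormal :: "real \<Rightarrow> real \<Rightarrow> nat \<Rightarrow> (nat \<Rightarrow> real \<Rightarrow> real) \<Rightarrow> bool" where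
  "bounded_orthonormal a b d x \<longleftrightarrow>
     (\<forall>i<d. x i \<in> borel_measurable lebesgue \<and> (\<exists>C. \<forall>t. \<bar>x i t\<bar> \<le> C)) \<and>
     (\<forall>i<d. \<forall>j<d. (LINT t:{a..b}|lebesgue. x i t * x j t) = (if i = j then 1 else 0))"

lemma bounded_orthonormal_measurable:
  "bounded_orthonormal a b d x \<Longrightarrow> i < d \<Longrightarrow> set_borel_measurable lebesgue {\<alpha>..\<beta>} (x i)"
  by (simp add: bounded_orthonormal_def set_borel_measurable_Icc)

lemma bounded_orthonormal_bound:
  assumes "bounded_orthonormal a b d x" "i < d"
  obtains C where "\<And>t. t \<in> A \<Longrightarrow> \<bar>x i t\<bar> \<le> C"
  using assms unfolding bounded_orthonormal_def by meson

lemma bounded_orthonormal_mult_integrable: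
  assumes x: "bounded_orthonormal a b d x" and i: "i < d"
    and f: "set_integrable lebesgue {\<alpha>..\<beta>} f"
  shows "set_integrable lebesgue {\<alpha>..\<beta>} (\<lambda>t. f t * x i t)"
proof -
  obtain C where "\<And>t. t \<in> {\<alpha>..\<beta>} \<Longrightarrow> \<bar>x i t\<bar> \<le> C"
    using bounded_orthonormal_bound[OF x i] by blast
  then show ?thesis
    by (intro set_integrable_mult_bounded[OF f bounded_orthonormal_measurable[OF x i]])
qed

lemma bounded_orthonormal_integrable:
  assumes x: "bounded_orthonormal a b d x" and i: "i < d"
  shows "set_integrable lebesgue {\<alpha>..\<beta>} (x i)"
proof -
  obtain C where "\<And>t. t \<in> {\<alpha>..\<beta>} \<Longrightarrow> \<bar>x i t\<bar> \<le> C"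
    using bounded_orthonormal_bound[OF x i] by blast
  then show ?thesis
    by (intro set_integrable_Icc_bounded[OF bounded_orthonormal_measurable[OF x i]])
qed

lemma cell_borel: "cell p N j \<in> sets borel"
  by (simp add: cell_def)

lemma cell_subset: "cell p N j \<subseteq> {p j..p (Suc j)}"
  by (auto simp: cell_def)

text \<open>Each basis function is a polynomial cut off to a cell, and a cell lies in a compact interval, on
  which the polynomial is bounded.\<close>

lemma legendre_basis_bounded_orthonormal:
  assumes p: "interval_partition a b N p" and x: "legendre_basis p N k x"
  shows "bounded_orthonormal a b ((k + 1) * N) x"
proof -
  have "x i \<in> borel_measurable lebesgue \<and> (\<exists>C. \<forall>t. \<bar>x i t\<bar> \<le> C)" if "i < (k + 1) * N" for i
  proof -
    from x that obtain j l c where "j < N" and xi: "\<And>t. x i t = (if t \<in> cell p N j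
        then c * poly (legendre l) ((2 * t - p j - p (Suc j)) / (p (Suc j) - p j)) else 0)"
      unfolding legendre_basis_def by meson
    define q where "q t = c * poly (legendre l) ((2 * t - p j - p (Suc j)) / (p (Suc j) - p j))" for t
    have xi: "x i = (\<lambda>t. indicator (cell p N j) t * q t)"
      using xi by (auto simp: q_def)
    have neq: "p (Suc j) - p j \<noteq> 0"
      using p \<open>j < N\<close> by (auto simp: interval_partition_def dest!: spec[of _ j])
    have cont: "continuous_on A q" for A
      unfolding q_def using neq by (intro continuous_intros) auto
    have "x i \<in> borel_measurable borel"
      unfolding xi using cont[of UNIV]
      by (intro borel_measurable_times borel_measurable_indicator cell_borel
          borel_measurable_continuous_onI)
    moreover have "bounded (q ` {p j..p (Suc j)})"
      by (intro compact_imp_bounded compact_continuous_image cont) auto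
    then obtain C where C: "\<And>t. t \<in> {p j..p (Suc j)} \<Longrightarrow> \<bar>q t\<bar> \<le> C"
      unfolding bounded_iff real_norm_def by blast
    have "\<bar>x i t\<bar> \<le> max C 0" for t
      unfolding xi using C[of t] cell_subset[of p N j] by (auto simp: indicator_def)
    ultimately show ?thesis
      by (auto intro: measurable_completion)
  qed
  with p x show ?thesis
    unfolding bounded_orthonormal_def legendre_basis_def interval_partition_def by auto
qed

lemma parseval:
  assumes x: "bounded_orthonormal a b d x"
  shows "(LINT t:{a..b}|lebesgue. (\<Sum>i<d. \<alpha> i * x i t) * (\<Sum>i<d. \<beta> i * x i t))
    = (\<Sum>i<d. \<alpha> i * \<beta> i)"
proof -
  have int: "set_integrable lebesgue {a..b} (\<lambda>t. x i t * x j t)" if "i < d" "j < d" for i j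
    using that
    by (intro bounded_orthonormal_mult_integrable[OF x] bounded_orthonormal_integrable[OF x])
  have "(\<Sum>i<d. \<alpha> i * x i t) * (\<Sum>i<d. \<beta> i * x i t)
      = (\<Sum>i<d. \<Sum>j<d. (\<alpha> i * \<beta> j) * (x i t * x j t))" for t
    by (simp add: sum_product algebra_simps)
  then have "(LINT t:{a..b}|lebesgue. (\<Sum>i<d. \<alpha> i * x i t) * (\<Sum>i<d. \<beta> i * x i t))
      = (LINT t:{a..b}|lebesgue. (\<Sum>i<d. \<Sum>j<d. (\<alpha> i * \<beta> j) * (x i t * x j t)))"
    by simp
  also have "\<dots> = (\<Sum>i<d. \<Sum>j<d. (\<alpha> i * \<beta> j) * (LINT t:{a..b}|lebesgue. x i t * x j t))"
    by (intro set_integral_double_sum int) auto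
  also have "\<dots> = (\<Sum>i<d. \<Sum>j<d. if i = j then \<alpha> i * \<beta> j else 0)"
    using x by (intro sum.cong refl) (auto simp: bounded_orthonormal_def)
  finally show ?thesis by simp
qed

section \<open>The weak forms in coordinates\<close>

text \<open>Read as a function of the angle, \<open>X\<^sup>T F Y\<close> is a linear combination of the \<open>x\<^sub>i\<close> with
  coefficients \<open>(F Y)\<^sub>i\<close>, to which Parseval's identity applies.\<close>

lemma mat_fun_angular: "F \<in> carrier_mat m n \<Longrightarrow>
    mat_fun x y F \<mu> \<epsilon> = (\<Sum>i<m. (\<Sum>j<n. F $$ (i, j) * y j \<epsilon>) * x i \<mu>)"
  by (auto simp: mat_fun_def sum_distrib_left mult_ac intro!: sum.cong)

lemma mass_integrable:
  assumes y: "bounded_orthonormal 0 \<epsilon>max n y" and "i < n" "j < n"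
    and \<rho>: "set_borel_measurable lebesgue {0..\<epsilon>max} \<rho>"
      "\<And>\<epsilon>. \<epsilon> \<in> {0..\<epsilon>max} \<Longrightarrow> \<bar>\<rho> \<epsilon>\<bar> \<le> C"
  shows "set_integrable lebesgue {0..\<epsilon>max} (\<lambda>\<epsilon>. \<rho> \<epsilon> * y i \<epsilon> * y j \<epsilon> * \<epsilon>\<^sup>2)"
proof -
  have "set_integrable lebesgue {0..\<epsilon>max} (\<lambda>\<epsilon>. \<rho> \<epsilon> * y i \<epsilon> * y j \<epsilon>)"
    using assms
    by (intro bounded_orthonormal_mult_integrable[OF y] set_integrable_Icc_bounded[OF \<rho>])
  moreover have "\<bar>\<epsilon>\<^sup>2\<bar> \<le> \<epsilon>max\<^sup>2" if "\<epsilon> \<in> {0..\<epsilon>max}" for \<epsilon>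
    using that by (auto intro: power_mono)
  ultimately show ?thesis
    by (rule set_integrable_mult_bounded[OF _ set_borel_measurable_Icc[OF square_borel_lebesgue]])
qed

lemma mass_mat_carrier: "mass_mat \<epsilon>max \<rho> n y \<in> carrier_mat n n"
  by (simp add: mass_mat_def)

text \<open>Parseval's identity in the angle leaves \<open>\<Sum>\<^sub>i (F Y)\<^sub>i (W Y)\<^sub>i\<close>, and the energy integral of the
  products \<open>y\<^sub>j y\<^sub>l\<close> produces the mass matrix.\<close>

lemma weighted_inner_mat_fun:
  assumes x: "bounded_orthonormal (-1) 1 m x" and y: "bounded_orthonormal 0 \<epsilon>max n y"
    and \<rho>: "set_borel_measurable lebesgue {0..\<epsilon>max} \<rho>"
      "\<And>\<epsilon>. \<epsilon> \<in> {0..\<epsilon>max} \<Longrightarrow> \<bar>\<rho> \<epsilon>\<bar> \<le> C"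
    and F: "F \<in> carrier_mat m n" and W: "W \<in> carrier_mat m n"
  shows "weighted_inner \<epsilon>max (\<lambda>\<mu> \<epsilon>. \<rho> \<epsilon> * mat_fun x y F \<mu> \<epsilon>) (mat_fun x y W)
    = frob (F * mass_mat \<epsilon>max \<rho> n y) W"
proof -
  note int = mass_integrable[OF y _ _ \<rho>]
  let ?f = "\<lambda>i \<epsilon>. \<Sum>j<n. F $$ (i, j) * y j \<epsilon>"
  let ?w = "\<lambda>i \<epsilon>. \<Sum>j<n. W $$ (i, j) * y j \<epsilon>"
  let ?c = "\<lambda>j l. \<Sum>i<m. F $$ (i, j) * W $$ (i, l)"
  have "(LINT \<mu>:{-1..1}|lebesgue. \<rho> \<epsilon> * mat_fun x y F \<mu> \<epsilon> * mat_fun x y W \<mu> \<epsilon> * \<epsilon>\<^sup>2)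
      = (\<Sum>j<n. \<Sum>l<n. ?c j l * (\<rho> \<epsilon> * y j \<epsilon> * y l \<epsilon> * \<epsilon>\<^sup>2))" for \<epsilon>
  proof -
    have "(LINT \<mu>:{-1..1}|lebesgue. \<rho> \<epsilon> * mat_fun x y F \<mu> \<epsilon> * mat_fun x y W \<mu> \<epsilon> * \<epsilon>\<^sup>2)
      = (LINT \<mu>:{-1..1}|lebesgue. (\<rho> \<epsilon> * \<epsilon>\<^sup>2) *
          ((\<Sum>i<m. ?f i \<epsilon> * x i \<mu>) * (\<Sum>i<m. ?w i \<epsilon> * x i \<mu>)))"
      by (simp add: mat_fun_angular[OF F] mat_fun_angular[OF W] mult_ac)
    also have "\<dots> = (\<rho> \<epsilon> * \<epsilon>\<^sup>2) * (\<Sum>i<m. ?f i \<epsilon> * ?w i \<epsilon>)"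
      by (subst set_integral_mult_right) (simp only: parseval[OF x])
    also have "\<dots> = (\<Sum>i<m. \<Sum>j<n. \<Sum>l<n. (F $$ (i, j) * W $$ (i, l)) * (\<rho> \<epsilon> * y j \<epsilon> * y l \<epsilon> * \<epsilon>\<^sup>2))"
      unfolding sum_product by (simp add: sum_distrib_left mult_ac)
    also have "\<dots> = (\<Sum>j<n. \<Sum>l<n. \<Sum>i<m. (F $$ (i, j) * W $$ (i, l)) * (\<rho> \<epsilon> * y j \<epsilon> * y l \<epsilon> * \<epsilon>\<^sup>2))"
      by (subst sum.swap) (intro sum.cong refl sum.swap)
    also have "\<dots> = (\<Sum>j<n. \<Sum>l<n. ?c j l * (\<rho> \<epsilon> * y j \<epsilon> * y l \<epsilon> * \<epsilon>\<^sup>2))"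
      by (simp only: sum_distrib_right)
    finally show ?thesis .
  qed
  then have "weighted_inner \<epsilon>max (\<lambda>\<mu> \<epsilon>. \<rho> \<epsilon> * mat_fun x y F \<mu> \<epsilon>) (mat_fun x y W)
    = (LINT \<epsilon>:{0..\<epsilon>max}|lebesgue. (\<Sum>j<n. \<Sum>l<n. ?c j l * (\<rho> \<epsilon> * y j \<epsilon> * y l \<epsilon> * \<epsilon>\<^sup>2)))"
    unfolding weighted_inner_def by simp
  also have "\<dots> = (\<Sum>j<n. \<Sum>l<n. ?c j l * (LINT \<epsilon>:{0..\<epsilon>max}|lebesgue. \<rho> \<epsilon> * y j \<epsilon> * y l \<epsilon> * \<epsilon>\<^sup>2))"
    by (intro set_integral_double_sum int) auto
  also have "\<dots> = (\<Sum>j<n. \<Sum>l<n. \<Sum>i<m. F $$ (i, j) * mass_mat \<epsilon>max \<rho> n y $$ (j, l) * W $$ (i, l))"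
    by (intro sum.cong refl) (simp add: mass_mat_def sum_distrib_right mult_ac)
  also have "\<dots> = (\<Sum>l<n. \<Sum>i<m. \<Sum>j<n. F $$ (i, j) * mass_mat \<epsilon>max \<rho> n y $$ (j, l) * W $$ (i, l))"
    by (subst sum.swap) (intro sum.cong refl sum.swap)
  also have "\<dots> = (\<Sum>i<m. \<Sum>l<n. \<Sum>j<n. F $$ (i, j) * mass_mat \<epsilon>max \<rho> n y $$ (j, l) * W $$ (i, l))"
    by (rule sum.swap)
  also have "\<dots> = frob (F * mass_mat \<epsilon>max \<rho> n y) W"
    using F W mass_mat_carrier[of \<epsilon>max \<rho> n y]
    by (auto simp: frob_def scalar_prod_def sum_distrib_right atLeast0LessThan intro!: sum.cong)
  finally show ?thesis .
qed

text \<open>Square integrability of \<open>\<eta>\<close> for the measure \<open>\<epsilon>\<^sup>2 d\<epsilon>\<close> says that \<open>\<eta> \<epsilon>\<close> is square integrable. As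
  \<open>\<bar>s\<bar> \<le> 1 + s\<^sup>2\<close>, it is then integrable on the bounded interval, and the remaining factors
  \<open>y\<^sub>i\<close> and \<open>\<epsilon>\<close> are bounded.\<close>

lemma emission_integrable:
  assumes y: "bounded_orthonormal 0 \<epsilon>max n y" and "i < n"
    and \<eta>: "set_borel_measurable lebesgue {0..\<epsilon>max} \<eta>"
      "set_integrable lebesgue {0..\<epsilon>max} (\<lambda>\<epsilon>. (\<eta> \<epsilon>)\<^sup>2 * \<epsilon>\<^sup>2)"
  shows "set_integrable lebesgue {0..\<epsilon>max} (\<lambda>\<epsilon>. \<eta> \<epsilon> * y i \<epsilon> * \<epsilon>\<^sup>2)"
proof -
  have id: "set_borel_measurable lebesgue {0..\<epsilon>max} (\<lambda>\<epsilon>. \<epsilon>)"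
    by (intro set_borel_measurable_Icc measurable_completion) auto
  have le: "\<bar>s\<bar> \<le> 1 + s\<^sup>2" for s :: real
    using zero_le_power2[of "\<bar>s\<bar> - 1"] zero_le_power2[of s]
    by (simp add: power2_eq_square algebra_simps)
  have "set_integrable lebesgue {0..\<epsilon>max} (\<lambda>\<epsilon>. \<eta> \<epsilon> * \<epsilon>)"
  proof (rule set_integrable_bound)
    show "set_integrable lebesgue {0..\<epsilon>max} (\<lambda>\<epsilon>. 1 + (\<eta> \<epsilon>)\<^sup>2 * \<epsilon>\<^sup>2)"
      by (intro set_integral_add \<eta> set_integrable_Icc_one)
    show "set_borel_measurable lebesgue {0..\<epsilon>max} (\<lambda>\<epsilon>. \<eta> \<epsilon> * \<epsilon>)"
      by (intro set_borel_measurable_times \<eta> id)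
    show "AE \<epsilon> in lebesgue. \<epsilon> \<in> {0..\<epsilon>max} \<longrightarrow> norm (\<eta> \<epsilon> * \<epsilon>) \<le> norm (1 + (\<eta> \<epsilon>)\<^sup>2 * \<epsilon>\<^sup>2)"
      using le[of "\<eta> _ * _"] by (intro AE_I2) (simp add: power_mult_distrib add_nonneg_nonneg)
  qed
  then have "set_integrable lebesgue {0..\<epsilon>max} (\<lambda>\<epsilon>. \<eta> \<epsilon> * \<epsilon> * y i \<epsilon>)"
    by (rule bounded_orthonormal_mult_integrable[OF y \<open>i < n\<close>])
  then have "set_integrable lebesgue {0..\<epsilon>max} (\<lambda>\<epsilon>. \<eta> \<epsilon> * \<epsilon> * y i \<epsilon> * \<epsilon>)"
    by (rule set_integrable_mult_bounded[OF _ id, where C = \<epsilon>max]) auto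
  then show ?thesis
    by (simp add: power2_eq_square algebra_simps)
qed

lemma weighted_inner_emission:
  assumes x: "bounded_orthonormal (-1) 1 m x" and y: "bounded_orthonormal 0 \<epsilon>max n y"
    and \<eta>: "set_borel_measurable lebesgue {0..\<epsilon>max} \<eta>"
      "set_integrable lebesgue {0..\<epsilon>max} (\<lambda>\<epsilon>. (\<eta> \<epsilon>)\<^sup>2 * \<epsilon>\<^sup>2)"
    and W: "W \<in> carrier_mat m n"
  shows "weighted_inner \<epsilon>max (\<lambda>\<mu> \<epsilon>. \<eta> \<epsilon>) (mat_fun x y W)
    = frob (L0_mat m x * (Leta_mat \<epsilon>max \<eta> n y)\<^sup>T) W"
proof -
  note int = emission_integrable[OF y _ \<eta>]
  let ?w = "\<lambda>i \<epsilon>. \<Sum>j<n. W $$ (i, j) * y j \<epsilon>"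
  let ?l = "\<lambda>i. LINT \<mu>:{-1..1}|lebesgue. x i \<mu>"
  have "(LINT \<mu>:{-1..1}|lebesgue. \<eta> \<epsilon> * mat_fun x y W \<mu> \<epsilon> * \<epsilon>\<^sup>2)
      = (\<Sum>i<m. \<Sum>j<n. (W $$ (i, j) * ?l i) * (\<eta> \<epsilon> * y j \<epsilon> * \<epsilon>\<^sup>2))" for \<epsilon>
  proof -
    have "(LINT \<mu>:{-1..1}|lebesgue. \<eta> \<epsilon> * mat_fun x y W \<mu> \<epsilon> * \<epsilon>\<^sup>2)
      = (LINT \<mu>:{-1..1}|lebesgue. (\<eta> \<epsilon> * \<epsilon>\<^sup>2) * (\<Sum>i<m. ?w i \<epsilon> * x i \<mu>))"
      by (simp add: mat_fun_angular[OF W] algebra_simps)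
    also have "\<dots> = (\<eta> \<epsilon> * \<epsilon>\<^sup>2) * (\<Sum>i<m. ?w i \<epsilon> * ?l i)"
      by (subst set_integral_mult_right, subst set_integral_sum)
        (auto intro: bounded_orthonormal_integrable[OF x])
    also have "\<dots> = (\<Sum>i<m. \<Sum>j<n. (W $$ (i, j) * ?l i) * (\<eta> \<epsilon> * y j \<epsilon> * \<epsilon>\<^sup>2))"
      by (simp add: sum_distrib_left sum_distrib_right algebra_simps)
    finally show ?thesis .
  qed
  then have "weighted_inner \<epsilon>max (\<lambda>\<mu> \<epsilon>. \<eta> \<epsilon>) (mat_fun x y W)
    = (LINT \<epsilon>:{0..\<epsilon>max}|lebesgue.
        (\<Sum>i<m. \<Sum>j<n. (W $$ (i, j) * ?l i) * (\<eta> \<epsilon> * y j \<epsilon> * \<epsilon>\<^sup>2)))"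
    unfolding weighted_inner_def by simp
  also have "\<dots> = (\<Sum>i<m. \<Sum>j<n. (W $$ (i, j) * ?l i) *
      (LINT \<epsilon>:{0..\<epsilon>max}|lebesgue. \<eta> \<epsilon> * y j \<epsilon> * \<epsilon>\<^sup>2))"
    by (intro set_integral_double_sum int) auto
  also have "\<dots> = frob (L0_mat m x * (Leta_mat \<epsilon>max \<eta> n y)\<^sup>T) W"
    using W
    by (auto simp: frob_def scalar_prod_def L0_mat_def Leta_mat_def algebra_simps intro!: sum.cong)
  finally show ?thesis .
qed

lemma mass_mat_symmetric: "(mass_mat \<epsilon>max \<rho> n y)\<^sup>T = mass_mat \<epsilon>max \<rho> n y"
  by (rule eq_matI) (simp_all add: mass_mat_def algebra_simps)

lemma mass_mat_add:
  assumes y: "bounded_orthonormal 0 \<epsilon>max n y"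
    and \<rho>: "set_borel_measurable lebesgue {0..\<epsilon>max} \<rho>"
      "\<And>\<epsilon>. \<epsilon> \<in> {0..\<epsilon>max} \<Longrightarrow> \<bar>\<rho> \<epsilon>\<bar> \<le> C"
    and \<sigma>: "set_borel_measurable lebesgue {0..\<epsilon>max} \<sigma>"
      "\<And>\<epsilon>. \<epsilon> \<in> {0..\<epsilon>max} \<Longrightarrow> \<bar>\<sigma> \<epsilon>\<bar> \<le> D"
  shows "mass_mat \<epsilon>max (\<lambda>\<epsilon>. \<rho> \<epsilon> + c * \<sigma> \<epsilon>) n y
    = mass_mat \<epsilon>max \<rho> n y + c \<cdot>\<^sub>m mass_mat \<epsilon>max \<sigma> n y"
proof (rule eq_matI)
  fix i j assume "i < dim_row (mass_mat \<epsilon>max \<rho> n y + c \<cdot>\<^sub>m mass_mat \<epsilon>max \<sigma> n y)"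
    and "j < dim_col (mass_mat \<epsilon>max \<rho> n y + c \<cdot>\<^sub>m mass_mat \<epsilon>max \<sigma> n y)"
  then have ij: "i < n" "j < n" by (simp_all add: mass_mat_def)
  have "(LINT \<epsilon>:{0..\<epsilon>max}|lebesgue. (\<rho> \<epsilon> + c * \<sigma> \<epsilon>) * y i \<epsilon> * y j \<epsilon> * \<epsilon>\<^sup>2)
    = (LINT \<epsilon>:{0..\<epsilon>max}|lebesgue. \<rho> \<epsilon> * y i \<epsilon> * y j \<epsilon> * \<epsilon>\<^sup>2
        + c * (\<sigma> \<epsilon> * y i \<epsilon> * y j \<epsilon> * \<epsilon>\<^sup>2))"
    by (simp add: algebra_simps)
  also have "\<dots> = (LINT \<epsilon>:{0..\<epsilon>max}|lebesgue. \<rho> \<epsilon> * y i \<epsilon> * y j \<epsilon> * \<epsilon>\<^sup>2)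
      + c * (LINT \<epsilon>:{0..\<epsilon>max}|lebesgue. \<sigma> \<epsilon> * y i \<epsilon> * y j \<epsilon> * \<epsilon>\<^sup>2)"
    using mass_integrable[OF y ij \<rho>] mass_integrable[OF y ij \<sigma>]
    by (subst set_integral_add) auto
  finally show "mass_mat \<epsilon>max (\<lambda>\<epsilon>. \<rho> \<epsilon> + c * \<sigma> \<epsilon>) n y $$ (i, j)
      = (mass_mat \<epsilon>max \<rho> n y + c \<cdot>\<^sub>m mass_mat \<epsilon>max \<sigma> n y) $$ (i, j)"
    using ij by (simp add: mass_mat_def)
qed (simp_all add: mass_mat_def)

text \<open>For \<open>g = \<Sum>\<^sub>j v\<^sub>j y\<^sub>j\<close> the quadratic form is the integral of \<open>\<rho> g\<^sup>2 \<epsilon>\<^sup>2\<close>. If it vanishes, then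
  \<open>g = 0\<close> almost everywhere, because the weight \<open>\<rho> \<epsilon>\<^sup>2\<close> is zero only at \<open>\<epsilon> = 0\<close>. Then the
  unweighted integral of \<open>g\<^sup>2\<close>, which is \<open>\<Sum>\<^sub>j v\<^sub>j\<^sup>2\<close> by Parseval's identity, vanishes too.\<close>

lemma mass_mat_definite:
  assumes y: "bounded_orthonormal 0 \<epsilon>max n y"
    and \<rho>: "set_borel_measurable lebesgue {0..\<epsilon>max} \<rho>"
      "\<And>\<epsilon>. \<epsilon> \<in> {0..\<epsilon>max} \<Longrightarrow> 0 < \<rho> \<epsilon> \<and> \<rho> \<epsilon> \<le> C"
    and v: "v \<in> carrier_vec n" and null: "v \<bullet> (mass_mat \<epsilon>max \<rho> n y *\<^sub>v v) = 0"
  shows "v = 0\<^sub>v n"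
proof -
  let ?I = "{0..\<epsilon>max}"
  define g where "g \<epsilon> = (\<Sum>j<n. v $ j * y j \<epsilon>)" for \<epsilon>
  have C: "\<epsilon> \<in> ?I \<Longrightarrow> \<bar>\<rho> \<epsilon>\<bar> \<le> C" for \<epsilon>
    using \<rho>(2)[of \<epsilon>] by simp
  note int = mass_integrable[OF y _ _ \<rho>(1) C]
  have expand: "\<rho> \<epsilon> * (g \<epsilon>)\<^sup>2 * \<epsilon>\<^sup>2
      = (\<Sum>i<n. \<Sum>j<n. (v $ i * v $ j) * (\<rho> \<epsilon> * y i \<epsilon> * y j \<epsilon> * \<epsilon>\<^sup>2))" for \<epsilon>
    by (simp add: g_def power2_eq_square sum_product sum_distrib_left sum_distrib_right algebra_simps)
  have g_int: "set_integrable lebesgue ?I (\<lambda>\<epsilon>. \<rho> \<epsilon> * (g \<epsilon>)\<^sup>2 * \<epsilon>\<^sup>2)"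
    unfolding expand by (intro set_integrable_sum set_integrable_mult_right int) auto
  have "(LINT \<epsilon>:?I|lebesgue. \<rho> \<epsilon> * (g \<epsilon>)\<^sup>2 * \<epsilon>\<^sup>2)
      = (\<Sum>i<n. \<Sum>j<n. (v $ i * v $ j) * (LINT \<epsilon>:?I|lebesgue. \<rho> \<epsilon> * y i \<epsilon> * y j \<epsilon> * \<epsilon>\<^sup>2))"
    unfolding expand
    by (intro set_integral_double_sum int) auto
  also have "\<dots> = v \<bullet> (mass_mat \<epsilon>max \<rho> n y *\<^sub>v v)"
    using v by (auto simp: scalar_prod_def mass_mat_def mult_mat_vec_def sum_distrib_left
        atLeast0LessThan algebra_simps intro!: sum.cong)
  finally have "(LINT \<epsilon>|lebesgue. indicator ?I \<epsilon> *\<^sub>R (\<rho> \<epsilon> * (g \<epsilon>)\<^sup>2 * \<epsilon>\<^sup>2)) = 0"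
    using null by (simp add: set_lebesgue_integral_def)
  then have "AE \<epsilon> in lebesgue. indicator ?I \<epsilon> *\<^sub>R (\<rho> \<epsilon> * (g \<epsilon>)\<^sup>2 * \<epsilon>\<^sup>2) = 0"
  proof (subst (asm) integral_nonneg_eq_0_iff_AE)
    show "integrable lebesgue (\<lambda>\<epsilon>. indicator ?I \<epsilon> *\<^sub>R (\<rho> \<epsilon> * (g \<epsilon>)\<^sup>2 * \<epsilon>\<^sup>2))"
      using g_int by (simp only: set_integrable_def)
    show "AE \<epsilon> in lebesgue. 0 \<le> indicator ?I \<epsilon> *\<^sub>R (\<rho> \<epsilon> * (g \<epsilon>)\<^sup>2 * \<epsilon>\<^sup>2)"
      using \<rho>(2) by (intro AE_I2) (auto simp: indicator_def less_imp_le)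
  qed
  moreover have "AE \<epsilon> in lebesgue. \<epsilon> \<noteq> (0 :: real)"
    by (intro AE_completion AE_lborel_singleton)
  ultimately have "AE \<epsilon> in lebesgue. indicator ?I \<epsilon> *\<^sub>R (g \<epsilon> * g \<epsilon>) = 0"
  proof eventually_elim
    case (elim \<epsilon>)
    then show ?case using \<rho>(2)[of \<epsilon>] by (auto simp: indicator_def)
  qed
  then have "(LINT \<epsilon>:?I|lebesgue. g \<epsilon> * g \<epsilon>) = 0"
    unfolding set_lebesgue_integral_def by (rule integral_eq_zero_AE)
  then have "(\<Sum>j<n. v $ j * v $ j) = 0"
    using parseval[OF y, of "\<lambda>j. v $ j" "\<lambda>j. v $ j"] by (simp add: g_def)
  then have "\<forall>j\<in>{..<n}. v $ j * v $ j = 0"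
    by (subst (asm) sum_nonneg_eq_0_iff) auto
  then show ?thesis
    using v by (intro eq_vecI) auto
qed

lemma mult_assoc_dim:
  fixes A :: "'a :: semiring_0 mat"
  assumes "dim_col A = dim_row B" "dim_col B = dim_row C"
  shows "A * B * C = A * (B * C)"
  using assms by (intro assoc_mult_mat) auto

section \<open>The implicit step on a general trial space\<close>

lemma implicit_step_rearrange:
  fixes dt :: real
  assumes "dt > 0" and "X \<in> carrier_mat a b" "Y \<in> carrier_mat a b" "R \<in> carrier_mat a b" "H \<in> carrier_mat a b"
  shows "(1 / dt) \<cdot>\<^sub>m (X - R) = H - Y \<longleftrightarrow> X + dt \<cdot>\<^sub>m Y = R + dt \<cdot>\<^sub>m H"
  using assms by (auto simp: mat_eq_iff field_simps)

lemma mat_fun_scaled_diff: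
  assumes "F \<in> carrier_mat m n" "F0 \<in> carrier_mat m n"
  shows "(mat_fun x y F \<mu> \<epsilon> - mat_fun x y F0 \<mu> \<epsilon>) / dt
    = mat_fun x y ((1 / dt) \<cdot>\<^sub>m (F - F0)) \<mu> \<epsilon>"
  using assms
  by (simp add: mat_fun_def sum_subtractf[symmetric] sum_divide_distrib field_simps)

locale collision_problem =
  fixes \<epsilon>max chimin chimax dt :: real and \<eta> chi :: "real \<Rightarrow> real"
    and m n :: nat and x y :: "nat \<Rightarrow> real \<Rightarrow> real"
  assumes x: "bounded_orthonormal (-1) 1 m x" and y: "bounded_orthonormal 0 \<epsilon>max n y"
    and \<eta>: "set_borel_measurable lebesgue {0..\<epsilon>max} \<eta>"
      "set_integrable lebesgue {0..\<epsilon>max} (\<lambda>\<epsilon>. (\<eta> \<epsilon>)\<^sup>2 * \<epsilon>\<^sup>2)"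
    and chi: "set_borel_measurable lebesgue {0..\<epsilon>max} chi" "0 < chimin"
      "\<And>\<epsilon>. \<epsilon> \<in> {0..\<epsilon>max} \<Longrightarrow> chimin \<le> chi \<epsilon> \<and> chi \<epsilon> \<le> chimax"
    and dt: "dt > 0"
begin

abbreviation "A1 \<equiv> mass_mat \<epsilon>max (\<lambda>_. 1) n y"
abbreviation "Achi \<equiv> mass_mat \<epsilon>max chi n y"
abbreviation "Aimp \<equiv> mass_mat \<epsilon>max (\<lambda>\<epsilon>. 1 + dt * chi \<epsilon>) n y"
abbreviation "H \<equiv> L0_mat m x * (Leta_mat \<epsilon>max \<eta> n y)\<^sup>T"
abbreviation "G \<equiv> G_mat \<epsilon>max \<eta> chi m n x y"

definition trial_space :: "nat \<Rightarrow> nat \<Rightarrow> real mat \<Rightarrow> real mat \<Rightarrow> (real \<Rightarrow> real \<Rightarrow> real) set" where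
  "trial_space a b P Q = {mat_fun x y (P * M * Q\<^sup>T) | M. M \<in> carrier_mat a b}"

text \<open>The matrix equation for the Galerkin problem on \<open>trial_space a b P Q\<close> with initial value
  \<open>X\<^sup>T F0 Y\<close>; the unknown is \<open>M\<close>.\<close>

definition projected_step :: "real mat \<Rightarrow> real mat \<Rightarrow> real mat \<Rightarrow> real mat \<Rightarrow> bool" where
  "projected_step P Q F0 M \<longleftrightarrow>
     P\<^sup>T * ((1 / dt) \<cdot>\<^sub>m (P * M * Q\<^sup>T - F0) * A1) * Q = P\<^sup>T * G (P * M * Q\<^sup>T) * Q"

lemma one_measurable: "set_borel_measurable lebesgue {0..\<epsilon>max} (\<lambda>_. 1 :: real)"
  by (intro set_borel_measurable_Icc) auto

text \<open>The weight \<open>1 + \<Delta>t \<chi>\<close> collects all that multiplies the unknown in an implicit Euler step.\<close>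

lemma implicit_weight:
  "set_borel_measurable lebesgue {0..\<epsilon>max} (\<lambda>\<epsilon>. 1 + dt * chi \<epsilon>)"
  "\<epsilon> \<in> {0..\<epsilon>max} \<Longrightarrow> 0 < 1 + dt * chi \<epsilon> \<and> 1 + dt * chi \<epsilon> \<le> 1 + dt * chimax"
proof -
  have "(\<lambda>\<epsilon>. indicator {0..\<epsilon>max} \<epsilon> *\<^sub>R (1 :: real) + dt * (indicator {0..\<epsilon>max} \<epsilon> *\<^sub>R chi \<epsilon>))
      \<in> borel_measurable lebesgue"
    using one_measurable chi(1) unfolding set_borel_measurable_def
    by (intro borel_measurable_add borel_measurable_times borel_measurable_const)
  then show "set_borel_measurable lebesgue {0..\<epsilon>max} (\<lambda>\<epsilon>. 1 + dt * chi \<epsilon>)"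
    unfolding set_borel_measurable_def by (simp add: algebra_simps)
  assume "\<epsilon> \<in> {0..\<epsilon>max}"
  then show "0 < 1 + dt * chi \<epsilon> \<and> 1 + dt * chi \<epsilon> \<le> 1 + dt * chimax"
    using chi(2) chi(3)[of \<epsilon>] dt by (auto intro!: add_pos_pos mult_left_mono)
qed

lemma chi_bound: "\<epsilon> \<in> {0..\<epsilon>max} \<Longrightarrow> \<bar>chi \<epsilon>\<bar> \<le> chimax"
  using chi(2) chi(3)[of \<epsilon>] by auto

lemma H_carrier: "H \<in> carrier_mat m n"
  by (simp add: L0_mat_def Leta_mat_def carrier_matI)

lemma G_eq: "G F = H - F * Achi"
  by (simp add: G_mat_def)

lemma G_carrier: "F \<in> carrier_mat m n \<Longrightarrow> G F \<in> carrier_mat m n"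
  unfolding G_eq by (intro minus_carrier_mat mult_carrier_mat[of _ m n]) (auto simp: mass_mat_carrier)

lemma Aimp_eq: "Aimp = A1 + dt \<cdot>\<^sub>m Achi"
  by (rule mass_mat_add[OF y one_measurable _ chi(1) chi_bound, where C = 1]) auto

lemma A1_definite:
  "v \<in> carrier_vec n \<Longrightarrow> v \<bullet> (A1 *\<^sub>v v) = 0 \<Longrightarrow> v = 0\<^sub>v n"
  by (rule mass_mat_definite[OF y one_measurable, where C = 1]) auto

lemma Aimp_definite:
  "v \<in> carrier_vec n \<Longrightarrow> v \<bullet> (Aimp *\<^sub>v v) = 0 \<Longrightarrow> v = 0\<^sub>v n"
  by (rule mass_mat_definite[OF y implicit_weight])

text \<open>Both sides of the weak equation are Frobenius products with the coefficient matrix of the test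
  function.\<close>

lemma residual_frob:
  assumes F: "F \<in> carrier_mat m n" and F0: "F0 \<in> carrier_mat m n" and W: "W \<in> carrier_mat m n"
  shows "weighted_inner \<epsilon>max (\<lambda>\<mu> \<epsilon>. (mat_fun x y F \<mu> \<epsilon> - mat_fun x y F0 \<mu> \<epsilon>) / dt) (mat_fun x y W)
      = frob ((1 / dt) \<cdot>\<^sub>m (F - F0) * A1) W"
    and "collision_form \<epsilon>max \<eta> chi (mat_fun x y F) (mat_fun x y W) = frob (G F) W"
proof -
  have D: "(1 / dt) \<cdot>\<^sub>m (F - F0) \<in> carrier_mat m n"
    using F0 by (intro smult_carrier_mat minus_carrier_mat)
  show "weighted_inner \<epsilon>max (\<lambda>\<mu> \<epsilon>. (mat_fun x y F \<mu> \<epsilon> - mat_fun x y F0 \<mu> \<epsilon>) / dt) (mat_fun x y W)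
      = frob ((1 / dt) \<cdot>\<^sub>m (F - F0) * A1) W"
    using weighted_inner_mat_fun[OF x y one_measurable _ D W, of 1]
    by (simp add: mat_fun_scaled_diff[OF F F0])
  have FA: "F * Achi \<in> carrier_mat m n"
    by (rule mult_carrier_mat[OF F mass_mat_carrier])
  show "collision_form \<epsilon>max \<eta> chi (mat_fun x y F) (mat_fun x y W) = frob (G F) W"
    unfolding collision_form_def G_eq frob_diff[OF H_carrier FA W]
      weighted_inner_emission[OF x y \<eta> W]
    by (subst weighted_inner_mat_fun[OF x y chi(1) _ F W]) (use chi_bound in auto)
qed

lemma galerkin_iff_projected_step:
  assumes P: "P \<in> carrier_mat m a" and Q: "Q \<in> carrier_mat n b"
    and F0: "F0 \<in> carrier_mat m n" and M: "M \<in> carrier_mat a b"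
  shows "galerkin_solution \<epsilon>max \<eta> chi dt (mat_fun x y F0) (trial_space a b P Q)
      (mat_fun x y (P * M * Q\<^sup>T)) \<longleftrightarrow> projected_step P Q F0 M"
proof -
  let ?F = "P * M * Q\<^sup>T"
  have carrier: "P * W * Q\<^sup>T \<in> carrier_mat m n" if "W \<in> carrier_mat a b" for W
    using that P Q by (intro mult_carrier_mat[of _ _ b] mult_carrier_mat[of _ _ a]) auto
  note F = carrier[OF M]
  have D: "(1 / dt) \<cdot>\<^sub>m (?F - F0) * A1 \<in> carrier_mat m n"
    using F0 by (intro mult_carrier_mat[OF _ mass_mat_carrier] smult_carrier_mat minus_carrier_mat)
  have trial: "(\<forall>w\<in>trial_space a b P Q. \<Phi> w)
      \<longleftrightarrow> (\<forall>W\<in>carrier_mat a b. \<Phi> (mat_fun x y (P * W * Q\<^sup>T)))" for \<Phi>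
    unfolding trial_space_def by blast
  have "mat_fun x y ?F \<in> trial_space a b P Q"
    unfolding trial_space_def using M by blast
  then have "galerkin_solution \<epsilon>max \<eta> chi dt (mat_fun x y F0) (trial_space a b P Q) (mat_fun x y ?F)
    \<longleftrightarrow> (\<forall>W\<in>carrier_mat a b.
          frob ((1 / dt) \<cdot>\<^sub>m (?F - F0) * A1) (P * W * Q\<^sup>T) = frob (G ?F) (P * W * Q\<^sup>T))"
    unfolding galerkin_solution_def trial
    by (simp only: residual_frob[OF F F0 carrier] simp_thms cong: ball_cong)
  also have "\<dots> \<longleftrightarrow> projected_step P Q F0 M"
    unfolding projected_step_def by (rule frob_test_sandwich[OF D G_carrier[OF F] P Q])
  finally show ?thesis .
qed

text \<open>By \<open>P\<^sup>T P = I\<close> the new value enters the projected time difference through \<open>M (Q\<^sup>T A\<^sub>1 Q)\<close>, which is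
  \<open>M\<close> itself when \<open>Q\<close> is orthonormal for \<open>A\<^sub>1\<close>.\<close>

lemma projected_time_difference:
  assumes P: "P \<in> carrier_mat m a" and PP: "P\<^sup>T * P = 1\<^sub>m a" and Q: "Q \<in> carrier_mat n b"
    and F0: "F0 \<in> carrier_mat m n" and M: "M \<in> carrier_mat a b"
  shows "P\<^sup>T * ((1 / dt) \<cdot>\<^sub>m (P * M * Q\<^sup>T - F0) * A1) * Q
    = (1 / dt) \<cdot>\<^sub>m (M * (Q\<^sup>T * A1 * Q) - P\<^sup>T * F0 * A1 * Q)"
proof -
  note A1 = mass_mat_carrier[of \<epsilon>max "\<lambda>_. 1" n y]
  have PT: "P\<^sup>T \<in> carrier_mat a m" and QT: "Q\<^sup>T \<in> carrier_mat b n" using P Q by auto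
  have F: "P * M * Q\<^sup>T \<in> carrier_mat m n"
    using P Q M by (intro mult_carrier_mat[of _ _ b] mult_carrier_mat[of _ _ a]) auto
  have D: "P * M * Q\<^sup>T - F0 \<in> carrier_mat m n" using F0 by (intro minus_carrier_mat)
  have DA: "(P * M * Q\<^sup>T - F0) * A1 \<in> carrier_mat m n" by (rule mult_carrier_mat[OF D A1])
  have "P\<^sup>T * ((1 / dt) \<cdot>\<^sub>m (P * M * Q\<^sup>T - F0) * A1) * Q
      = (1 / dt) \<cdot>\<^sub>m (P\<^sup>T * ((P * M * Q\<^sup>T - F0) * A1) * Q)"
    unfolding mult_smult_assoc_mat[OF D A1] mult_smult_distrib[OF PT DA]
      mult_smult_assoc_mat[OF mult_carrier_mat[OF PT DA] Q] ..
  also have "P\<^sup>T * ((P * M * Q\<^sup>T - F0) * A1) * Q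
      = P\<^sup>T * (P * M * Q\<^sup>T * A1) * Q - P\<^sup>T * (F0 * A1) * Q"
    unfolding minus_mult_distrib_mat[OF F F0 A1]
      mult_minus_distrib_mat[OF PT mult_carrier_mat[OF F A1] mult_carrier_mat[OF F0 A1]]
      minus_mult_distrib_mat[OF mult_carrier_mat[OF PT mult_carrier_mat[OF F A1]]
        mult_carrier_mat[OF PT mult_carrier_mat[OF F0 A1]] Q] ..
  also have "P\<^sup>T * (P * M * Q\<^sup>T * A1) * Q = P\<^sup>T * P * (M * (Q\<^sup>T * A1 * Q))"
    using P Q M A1 by (simp add: mult_assoc_dim del: assoc_mult_mat)
  also have "\<dots> = M * (Q\<^sup>T * A1 * Q)"
    unfolding PP using M Q A1 by (intro left_mult_one_mat) auto
  also have "P\<^sup>T * (F0 * A1) * Q = P\<^sup>T * F0 * A1 * Q"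
    using P Q F0 A1 by (simp add: mult_assoc_dim del: assoc_mult_mat)
  finally show ?thesis .
qed

text \<open>Moving the absorption part \<open>F A\<^sub>\<chi>\<close> of \<open>G(F)\<close> to the left makes the equation linear in \<open>M\<close> with the
  implicit mass matrix; \<open>P\<^sup>T P = I\<close> removes \<open>P\<close> from the left-hand side.\<close>

lemma projected_step_linear:
  assumes P: "P \<in> carrier_mat m a" and PP: "P\<^sup>T * P = 1\<^sub>m a" and Q: "Q \<in> carrier_mat n b"
    and F0: "F0 \<in> carrier_mat m n" and M: "M \<in> carrier_mat a b"
  shows "projected_step P Q F0 M \<longleftrightarrow>
    M * (Q\<^sup>T * Aimp * Q) = P\<^sup>T * F0 * A1 * Q + dt \<cdot>\<^sub>m (P\<^sup>T * H * Q)"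
proof -
  note A1 = mass_mat_carrier[of \<epsilon>max "\<lambda>_. 1" n y] and Ac = mass_mat_carrier[of \<epsilon>max chi n y]
  note H = H_carrier
  have PT: "P\<^sup>T \<in> carrier_mat a m" and QT: "Q\<^sup>T \<in> carrier_mat b n" using P Q by auto
  have F: "P * M * Q\<^sup>T \<in> carrier_mat m n"
    using P Q M by (intro mult_carrier_mat[of _ _ b] mult_carrier_mat[of _ _ a]) auto
  note FA = mult_carrier_mat[OF F Ac]
  have QAQ: "Q\<^sup>T * A * Q \<in> carrier_mat b b" if "A \<in> carrier_mat n n" for A
    using Q that by auto
  have "P\<^sup>T * G (P * M * Q\<^sup>T) * Q = P\<^sup>T * H * Q - P\<^sup>T * (P * M * Q\<^sup>T * Achi) * Q"
    unfolding G_eq mult_minus_distrib_mat[OF PT H FA]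
      minus_mult_distrib_mat[OF mult_carrier_mat[OF PT H] mult_carrier_mat[OF PT FA] Q] ..
  also have "P\<^sup>T * (P * M * Q\<^sup>T * Achi) * Q = P\<^sup>T * P * (M * (Q\<^sup>T * Achi * Q))"
    using P Q M Ac by (simp add: mult_assoc_dim del: assoc_mult_mat)
  also have "\<dots> = M * (Q\<^sup>T * Achi * Q)"
    unfolding PP using M Q Ac by (intro left_mult_one_mat) auto
  finally have "projected_step P Q F0 M \<longleftrightarrow>
      (1 / dt) \<cdot>\<^sub>m (M * (Q\<^sup>T * A1 * Q) - P\<^sup>T * F0 * A1 * Q)
        = P\<^sup>T * H * Q - M * (Q\<^sup>T * Achi * Q)"
    unfolding projected_step_def projected_time_difference[OF assms] by simp
  also have "\<dots> \<longleftrightarrow> M * (Q\<^sup>T * A1 * Q) + dt \<cdot>\<^sub>m (M * (Q\<^sup>T * Achi * Q))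
        = P\<^sup>T * F0 * A1 * Q + dt \<cdot>\<^sub>m (P\<^sup>T * H * Q)"
  proof (rule implicit_step_rearrange[OF dt, where a = a and b = b])
    show "P\<^sup>T * F0 * A1 * Q \<in> carrier_mat a b"
      by (rule mult_carrier_mat[OF mult_carrier_mat[OF mult_carrier_mat[OF PT F0] A1] Q])
    show "P\<^sup>T * H * Q \<in> carrier_mat a b"
      by (rule mult_carrier_mat[OF mult_carrier_mat[OF PT H] Q])
  qed (rule mult_carrier_mat[OF M QAQ[OF A1]] mult_carrier_mat[OF M QAQ[OF Ac]])+
  also have "M * (Q\<^sup>T * A1 * Q) + dt \<cdot>\<^sub>m (M * (Q\<^sup>T * Achi * Q)) = M * (Q\<^sup>T * Aimp * Q)"
  proof -
    have dAc: "dt \<cdot>\<^sub>m Achi \<in> carrier_mat n n" using Ac by simp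
    have "Q\<^sup>T * Aimp * Q = Q\<^sup>T * A1 * Q + dt \<cdot>\<^sub>m (Q\<^sup>T * Achi * Q)"
      unfolding Aimp_eq mult_add_distrib_mat[OF QT A1 dAc]
        add_mult_distrib_mat[OF mult_carrier_mat[OF QT A1] smult_carrier_mat[OF mult_carrier_mat[OF QT Ac]] Q]
        mult_smult_distrib[OF QT Ac] mult_smult_assoc_mat[OF mult_carrier_mat[OF QT Ac] Q] ..
    then show ?thesis
      using mult_add_distrib_mat[OF M QAQ[OF A1], of "dt \<cdot>\<^sub>m (Q\<^sup>T * Achi * Q)"] QAQ[OF Ac]
        mult_smult_distrib[OF M QAQ[OF Ac]] by simp
  qed
  finally show ?thesis .
qed

text \<open>The left inverse \<open>Z\<close> expresses that \<open>Q\<close> has full column rank. For \<open>Q = E\<close> it is \<open>E\<^sup>T A\<^sub>1\<close>.\<close>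

lemma projected_step_unique:
  assumes P: "P \<in> carrier_mat m a" and PP: "P\<^sup>T * P = 1\<^sub>m a" and Q: "Q \<in> carrier_mat n b"
    and Z: "Z \<in> carrier_mat b n" and ZQ: "Z * Q = 1\<^sub>m b"
    and F0: "F0 \<in> carrier_mat m n"
  shows "\<exists>!M. M \<in> carrier_mat a b \<and> projected_step P Q F0 M"
proof -
  have B: "Q\<^sup>T * Aimp * Q \<in> carrier_mat b b"
    using Q mass_mat_carrier[of \<epsilon>max "\<lambda>\<epsilon>. 1 + dt * chi \<epsilon>" n y] by auto
  have PT: "P\<^sup>T \<in> carrier_mat a m" using P by simp
  have R: "P\<^sup>T * F0 * A1 * Q + dt \<cdot>\<^sub>m (P\<^sup>T * H * Q) \<in> carrier_mat a b"
    by (intro add_carrier_mat smult_carrier_mat mult_carrier_mat[OF mult_carrier_mat[OF PT H_carrier] Q])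
  obtain B' where "B' \<in> carrier_mat b b" "Q\<^sup>T * Aimp * Q * B' = 1\<^sub>m b" "B' * (Q\<^sup>T * Aimp * Q) = 1\<^sub>m b"
    using definite_sandwich[OF mass_mat_carrier Aimp_definite Q Z ZQ] by blast
  from unique_right_division[OF B this R] show ?thesis
    using projected_step_linear[OF P PP Q F0] by (metis (no_types, lifting))
qed

text \<open>The algorithm is formulated with \<open>the (mat_inverse A1)\<close>, which is an inverse since \<open>A1\<close> is
  definite.\<close>

lemma A1_inverse:
  obtains C where "mat_inverse A1 = Some C" "C \<in> carrier_mat n n" "A1 * C = 1\<^sub>m n" "C * A1 = 1\<^sub>m n"
proof -
  note A1 = mass_mat_carrier[of \<epsilon>max "\<lambda>_. 1" n y]
  have "\<exists>B'\<in>carrier_mat n n. (1\<^sub>m n)\<^sup>T * A1 * 1\<^sub>m n * B' = 1\<^sub>m n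
      \<and> B' * ((1\<^sub>m n)\<^sup>T * A1 * 1\<^sub>m n) = 1\<^sub>m n"
    by (rule definite_sandwich[OF A1 A1_definite, where Z = "1\<^sub>m n"]) auto
  then have "A1 \<in> Units (ring_mat TYPE(real) n ())"
    using A1 by (auto simp: Units_def ring_mat_def)
  then obtain C where "mat_inverse A1 = Some C"
    using mat_inverse(1)[OF A1, of "()"] by (cases "mat_inverse A1") auto
  then show thesis
    using mat_inverse(2)[OF A1] that by blast
qed

end

section \<open>The three steps of the scheme\<close>

locale low_rank_step = collision_problem +
  fixes r :: nat and U S E :: "real mat" and QU QE :: "real mat \<Rightarrow> real mat"
  assumes U: "U \<in> carrier_mat m r" and S: "S \<in> carrier_mat r r" and E: "E \<in> carrier_mat n r"
    and UU: "U\<^sup>T * U = 1\<^sub>m r" and EE: "E\<^sup>T * A1 * E = 1\<^sub>m r"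
    and QU: "\<And>K. K \<in> carrier_mat m r \<Longrightarrow> qr_factor (1\<^sub>m m) m r K (QU K)"
    and QE: "\<And>L. L \<in> carrier_mat n r \<Longrightarrow> qr_factor A1 n r L (QE L)"
begin

abbreviation "F0 \<equiv> U * S * E\<^sup>T"

lemma F0_carrier: "F0 \<in> carrier_mat m n"
  using U S E by auto

lemma QU_carrier: "K \<in> carrier_mat m r \<Longrightarrow> QU K \<in> carrier_mat m r"
  and QE_carrier: "L \<in> carrier_mat n r \<Longrightarrow> QE L \<in> carrier_mat n r"
  using QU QE by (auto simp: qr_factor_def)

lemma QU_orthonormal: "K \<in> carrier_mat m r \<Longrightarrow> (QU K)\<^sup>T * QU K = 1\<^sub>m r"
  using QU[of K] by (auto simp: qr_factor_def)

lemma QE_orthonormal: "L \<in> carrier_mat n r \<Longrightarrow> (QE L)\<^sup>T * A1 * QE L = 1\<^sub>m r"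
  using QE[of L] by (auto simp: qr_factor_def)

lemma V1_trial: "V1_space x y m r E = trial_space m r (1\<^sub>m m) E"
proof -
  have "f = mat_fun x y (K * E\<^sup>T) \<and> K \<in> carrier_mat m r \<longleftrightarrow>
      f = mat_fun x y (1\<^sub>m m * K * E\<^sup>T) \<and> K \<in> carrier_mat m r" for f K
    by (cases "K \<in> carrier_mat m r") (simp_all only: left_mult_one_mat simp_thms)
  then show ?thesis
    unfolding V1_space_def trial_space_def by (simp only:)
qed

lemma mult_one_transpose: "L \<in> carrier_mat n r \<Longrightarrow> U * L\<^sup>T * (1\<^sub>m n)\<^sup>T = U * L\<^sup>T"
  using U by (simp add: right_mult_one_mat[of "U * L\<^sup>T" m n])

lemma V2_trial: "V2_space x y n r U = trial_space r n U (1\<^sub>m n)"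
proof (intro equalityI subsetI)
  fix f assume "f \<in> V2_space x y n r U"
  then obtain L where L: "L \<in> carrier_mat n r" and f: "f = mat_fun x y (U * L\<^sup>T)"
    by (auto simp: V2_space_def)
  have "f = mat_fun x y (U * L\<^sup>T * (1\<^sub>m n)\<^sup>T)" "L\<^sup>T \<in> carrier_mat r n"
    using L by (simp_all only: f mult_one_transpose[OF L] transpose_carrier_mat)
  then show "f \<in> trial_space r n U (1\<^sub>m n)"
    unfolding trial_space_def by blast
next
  fix f assume "f \<in> trial_space r n U (1\<^sub>m n)"
  then obtain M where M: "M \<in> carrier_mat r n" and f: "f = mat_fun x y (U * M * (1\<^sub>m n)\<^sup>T)"
    by (auto simp: trial_space_def)
  have MT: "M\<^sup>T \<in> carrier_mat n r" using M by simp
  have "f = mat_fun x y (U * (M\<^sup>T)\<^sup>T)"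
    using mult_one_transpose[OF MT] by (simp only: f transpose_transpose)
  then show "f \<in> V2_space x y n r U"
    unfolding V2_space_def using MT by blast
qed

lemma V0_trial: "V0_space x y r P Q = trial_space r r P Q"
  by (simp add: V0_space_def trial_space_def)

definition K_step :: "real mat \<Rightarrow> bool" where
  "K_step K \<longleftrightarrow> (1 / dt) \<cdot>\<^sub>m (K - U * S) = G (K * E\<^sup>T) * E"

definition L_step :: "real mat \<Rightarrow> bool" where
  "L_step L \<longleftrightarrow> (1 / dt) \<cdot>\<^sub>m (L - E * S\<^sup>T) = the (mat_inverse A1) * (G (U * L\<^sup>T))\<^sup>T * U"

definition S_step :: "real mat \<Rightarrow> real mat \<Rightarrow> real mat \<Rightarrow> bool" where
  "S_step P Q T \<longleftrightarrow> (1 / dt) \<cdot>\<^sub>m (T - P\<^sup>T * U * S * E\<^sup>T * A1 * Q) = P\<^sup>T * G (P * T * Q\<^sup>T) * Q"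

text \<open>Here \<open>P = I\<close> and \<open>Q = E\<close>, and \<open>E\<^sup>T A\<^sub>1 E = I\<close> reduces \<open>(K E\<^sup>T - U S E\<^sup>T) A\<^sub>1 E\<close> to
  \<open>K - U S\<close>.\<close>

lemma K_step_projected:
  assumes K: "K \<in> carrier_mat m r"
  shows "projected_step (1\<^sub>m m) E F0 K \<longleftrightarrow> K_step K"
proof -
  note A1 = mass_mat_carrier[of \<epsilon>max "\<lambda>_. 1" n y]
  have ET: "E\<^sup>T \<in> carrier_mat r n" using E by simp
  have "1\<^sub>m m * F0 * A1 * E = U * S * (E\<^sup>T * A1 * E)"
    using U S E A1 F0_carrier by (simp add: mult_assoc_dim del: assoc_mult_mat)
  also have "\<dots> = U * S"
    unfolding EE using U S by (intro right_mult_one_mat[of _ m]) auto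
  finally have "(1\<^sub>m m)\<^sup>T * ((1 / dt) \<cdot>\<^sub>m (1\<^sub>m m * K * E\<^sup>T - F0) * A1) * E = (1 / dt) \<cdot>\<^sub>m (K - U * S)"
    using projected_time_difference[OF _ _ E F0_carrier K, of "1\<^sub>m m"] K
    by (simp add: EE)
  moreover have "1\<^sub>m m * G (K * E\<^sup>T) = G (K * E\<^sup>T)"
    by (rule left_mult_one_mat[OF G_carrier[OF mult_carrier_mat[OF K ET]]])
  ultimately show ?thesis
    using K by (simp add: projected_step_def K_step_def)
qed

text \<open>Here \<open>P = U\<close>, \<open>Q = I\<close> and the unknown is \<open>L\<^sup>T\<close>. The projected equation is
  \<open>(L\<^sup>T - S E\<^sup>T) A\<^sub>1 / \<Delta>t = U\<^sup>T G(U L\<^sup>T)\<close>; transposing it, with \<open>A\<^sub>1\<close> symmetric, and multiplying by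
  the inverse of \<open>A\<^sub>1\<close> gives the equation of the algorithm.\<close>

lemma L_step_projected:
  assumes L: "L \<in> carrier_mat n r"
  shows "projected_step U (1\<^sub>m n) F0 L\<^sup>T \<longleftrightarrow> L_step L"
proof -
  note A1 = mass_mat_carrier[of \<epsilon>max "\<lambda>_. 1" n y]
  have LT: "L\<^sup>T \<in> carrier_mat r n" and UT: "U\<^sup>T \<in> carrier_mat r m" using L U by auto
  have SE: "S * E\<^sup>T \<in> carrier_mat r n" using S E by auto
  have GL: "G (U * L\<^sup>T) \<in> carrier_mat m n" by (rule G_carrier[OF mult_carrier_mat[OF U LT]])
  define D where "D = (1 / dt) \<cdot>\<^sub>m (L - E * S\<^sup>T)"
  have D: "D \<in> carrier_mat n r"
    unfolding D_def using E S by (intro smult_carrier_mat minus_carrier_mat) auto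
  have DT: "(1 / dt) \<cdot>\<^sub>m (L\<^sup>T - S * E\<^sup>T) = D\<^sup>T"
  proof -
    have "(E * S\<^sup>T)\<^sup>T = S * E\<^sup>T"
      using E S by (subst transpose_mult) auto
    then have "L\<^sup>T - S * E\<^sup>T = (L - E * S\<^sup>T)\<^sup>T"
      using transpose_minus[OF L, of "E * S\<^sup>T"] E S by simp
    moreover have "(c \<cdot>\<^sub>m A)\<^sup>T = c \<cdot>\<^sub>m A\<^sup>T" for c and A :: "real mat"
      by (rule eq_matI) auto
    ultimately show ?thesis
      unfolding D_def by simp
  qed
  have "U\<^sup>T * F0 * A1 * 1\<^sub>m n = U\<^sup>T * U * (S * E\<^sup>T) * A1"
    using U S E A1 by (simp add: mult_assoc_dim del: assoc_mult_mat)
  also have "\<dots> = S * E\<^sup>T * A1"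
    unfolding UU left_mult_one_mat[OF SE] ..
  finally have "U\<^sup>T * ((1 / dt) \<cdot>\<^sub>m (U * L\<^sup>T * (1\<^sub>m n)\<^sup>T - F0) * A1) * 1\<^sub>m n
      = (1 / dt) \<cdot>\<^sub>m (L\<^sup>T * A1 - S * E\<^sup>T * A1)"
    using projected_time_difference[OF U UU one_carrier_mat F0_carrier LT] A1 by simp
  also have "\<dots> = D\<^sup>T * A1"
    unfolding DT[symmetric] minus_mult_distrib_mat[OF LT SE A1, symmetric]
    by (rule mult_smult_assoc_mat[OF minus_carrier_mat[OF SE] A1, symmetric])
  also have "D\<^sup>T * A1 = (A1 * D)\<^sup>T"
    using transpose_mult[OF A1 D] by (simp add: mass_mat_symmetric)
  finally have lhs: "U\<^sup>T * ((1 / dt) \<cdot>\<^sub>m (U * L\<^sup>T * (1\<^sub>m n)\<^sup>T - F0) * A1) * 1\<^sub>m n = (A1 * D)\<^sup>T" .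
  have "U\<^sup>T * G (U * L\<^sup>T) * 1\<^sub>m n = U\<^sup>T * G (U * L\<^sup>T)"
    by (rule right_mult_one_mat[OF mult_carrier_mat[OF UT GL]])
  also have "\<dots> = ((G (U * L\<^sup>T))\<^sup>T * U)\<^sup>T"
    using transpose_mult[of "(G (U * L\<^sup>T))\<^sup>T" n m U r] GL U by simp
  finally have "projected_step U (1\<^sub>m n) F0 L\<^sup>T \<longleftrightarrow> A1 * D = (G (U * L\<^sup>T))\<^sup>T * U"
    unfolding projected_step_def lhs unfolding mult_one_transpose[OF L] by simp
  also have "\<dots> \<longleftrightarrow> L_step L"
  proof -
    obtain C where C: "mat_inverse A1 = Some C" "C \<in> carrier_mat n n"
        "A1 * C = 1\<^sub>m n" "C * A1 = 1\<^sub>m n"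
      using A1_inverse .
    define B where "B = (G (U * L\<^sup>T))\<^sup>T * U"
    have B: "B \<in> carrier_mat n r" unfolding B_def using GL U by auto
    have "A1 * D = B \<longleftrightarrow> D = C * B"
      using assoc_mult_mat[OF C(2) A1 D] assoc_mult_mat[OF A1 C(2) B] C(3,4) B D by auto
    moreover have "C * (G (U * L\<^sup>T))\<^sup>T * U = C * B"
      unfolding B_def using C(2) GL U by (intro assoc_mult_mat[of _ n n _ m _ r]) auto
    ultimately show ?thesis
      unfolding L_step_def C(1) D_def[symmetric] B_def by simp
  qed
  finally show ?thesis .
qed

lemma S_step_projected:
  assumes P: "P \<in> carrier_mat m r" and PP: "P\<^sup>T * P = 1\<^sub>m r"
    and Q: "Q \<in> carrier_mat n r" and QQ: "Q\<^sup>T * A1 * Q = 1\<^sub>m r" and T: "T \<in> carrier_mat r r"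
  shows "projected_step P Q F0 T \<longleftrightarrow> S_step P Q T"
proof -
  have "P\<^sup>T * F0 * A1 * Q = P\<^sup>T * U * S * E\<^sup>T * A1 * Q"
    using P Q U S E mass_mat_carrier[of \<epsilon>max "\<lambda>_. 1" n y]
    by (simp add: mult_assoc_dim del: assoc_mult_mat)
  then show ?thesis
    unfolding projected_step_def S_step_def projected_time_difference[OF P PP Q F0_carrier T] QQ
    using T by simp
qed

lemma K_step_unique: "\<exists>!K. K \<in> carrier_mat m r \<and> K_step K"
proof -
  have "E\<^sup>T * A1 \<in> carrier_mat r n"
    using E mass_mat_carrier[of \<epsilon>max "\<lambda>_. 1" n y] by auto
  from projected_step_unique[OF one_carrier_mat _ E this EE F0_carrier]
  have "\<exists>!K. K \<in> carrier_mat m r \<and> projected_step (1\<^sub>m m) E F0 K" by simp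
  then show ?thesis
    using K_step_projected by (simp cong: conj_cong)
qed

lemma L_step_unique: "\<exists>!L. L \<in> carrier_mat n r \<and> L_step L"
proof -
  have "\<exists>!M. M \<in> carrier_mat r n \<and> projected_step U (1\<^sub>m n) F0 M"
    by (rule projected_step_unique[OF U UU one_carrier_mat one_carrier_mat _ F0_carrier]) simp
  then show ?thesis
    using L_step_projected by (metis transpose_carrier_mat transpose_transpose)
qed

lemma S_step_unique:
  assumes K: "K \<in> carrier_mat m r" and L: "L \<in> carrier_mat n r"
  shows "\<exists>!T. T \<in> carrier_mat r r \<and> S_step (QU K) (QE L) T"
proof -
  note P = QU_carrier[OF K] and PP = QU_orthonormal[OF K]
    and Q = QE_carrier[OF L] and QQ = QE_orthonormal[OF L]
  have "(QE L)\<^sup>T * A1 \<in> carrier_mat r n"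
    using Q mass_mat_carrier[of \<epsilon>max "\<lambda>_. 1" n y] by auto
  then have "\<exists>!T. T \<in> carrier_mat r r \<and> projected_step (QU K) (QE L) F0 T"
    by (rule projected_step_unique[OF P PP Q _ QQ F0_carrier])
  moreover have "T \<in> carrier_mat r r \<and> projected_step (QU K) (QE L) F0 T
      \<longleftrightarrow> T \<in> carrier_mat r r \<and> S_step (QU K) (QE L) T" for T
    using S_step_projected[OF P PP Q QQ] by blast
  ultimately show ?thesis by (simp only:)
qed

abbreviation "galerkin \<equiv> galerkin_solution \<epsilon>max \<eta> chi dt (mat_fun x y F0)"

lemma galerkin_K:
  assumes K: "K \<in> carrier_mat m r"
  shows "galerkin (V1_space x y m r E) (mat_fun x y (K * E\<^sup>T)) \<longleftrightarrow> K_step K"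
  using galerkin_iff_projected_step[OF one_carrier_mat E F0_carrier K]
  unfolding V1_trial K_step_projected[OF K] left_mult_one_mat[OF K] .

lemma galerkin_L:
  assumes L: "L \<in> carrier_mat n r"
  shows "galerkin (V2_space x y n r U) (mat_fun x y (U * L\<^sup>T)) \<longleftrightarrow> L_step L"
proof -
  have "L\<^sup>T \<in> carrier_mat r n" using L by simp
  from galerkin_iff_projected_step[OF U one_carrier_mat F0_carrier this] show ?thesis
    unfolding V2_trial L_step_projected[OF L] mult_one_transpose[OF L] .
qed

lemma galerkin_S:
  assumes K: "K \<in> carrier_mat m r" and L: "L \<in> carrier_mat n r" and T: "T \<in> carrier_mat r r"
  shows "galerkin (V0_space x y r (QU K) (QE L)) (mat_fun x y (QU K * T * (QE L)\<^sup>T))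
    \<longleftrightarrow> S_step (QU K) (QE L) T"
  using galerkin_iff_projected_step[OF QU_carrier[OF K] QE_carrier[OF L] F0_carrier T]
  unfolding V0_trial
    S_step_projected[OF QU_carrier[OF K] QU_orthonormal[OF K] QE_carrier[OF L] QE_orthonormal[OF L] T] .

lemma algorithm_iff: "algorithm_solution \<epsilon>max \<eta> chi m n r x y QU QE dt U S E K L T \<longleftrightarrow>
    K \<in> carrier_mat m r \<and> L \<in> carrier_mat n r \<and> T \<in> carrier_mat r r \<and>
    K_step K \<and> L_step L \<and> S_step (QU K) (QE L) T"
  unfolding algorithm_solution_def Let_def K_step_def L_step_def S_step_def by (rule refl)

text \<open>The matrices \<open>K\<close> and \<open>L\<close> that represent \<open>fK\<close> and \<open>fL\<close> in the scheme automatically solve the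
  matrix equations, since the weak equations do not depend on the chosen representation.\<close>

lemma scheme_iff: "scheme_solution \<epsilon>max \<eta> chi m n r x y QU QE dt U S E fK fL fS \<longleftrightarrow>
    (\<exists>K L T. algorithm_solution \<epsilon>max \<eta> chi m n r x y QU QE dt U S E K L T \<and>
      fK = mat_fun x y (K * E\<^sup>T) \<and> fL = mat_fun x y (U * L\<^sup>T) \<and>
      fS = mat_fun x y (QU K * T * (QE L)\<^sup>T))"
    (is "?scheme \<longleftrightarrow> ?algorithm")
proof
  assume ?scheme
  then obtain K L where K: "K \<in> carrier_mat m r" and L: "L \<in> carrier_mat n r"
    and f: "fK = mat_fun x y (K * E\<^sup>T)" "fL = mat_fun x y (U * L\<^sup>T)"
    and gal: "galerkin (V1_space x y m r E) fK" "galerkin (V2_space x y n r U) fL"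
      "galerkin (V0_space x y r (QU K) (QE L)) fS"
    unfolding scheme_solution_def Let_def by blast
  from gal(3) obtain T where T: "T \<in> carrier_mat r r" "fS = mat_fun x y (QU K * T * (QE L)\<^sup>T)"
    unfolding galerkin_solution_def V0_space_def by blast
  have "K_step K" "L_step L" "S_step (QU K) (QE L) T"
    using gal unfolding f T(2) galerkin_K[OF K] galerkin_L[OF L] galerkin_S[OF K L T(1)] .
  then show ?algorithm
    unfolding algorithm_iff using K L T f by blast
next
  assume ?algorithm
  then obtain K L T where K: "K \<in> carrier_mat m r" and L: "L \<in> carrier_mat n r"
    and T: "T \<in> carrier_mat r r" and steps: "K_step K" "L_step L" "S_step (QU K) (QE L) T"
    and f: "fK = mat_fun x y (K * E\<^sup>T)" "fL = mat_fun x y (U * L\<^sup>T)"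
      "fS = mat_fun x y (QU K * T * (QE L)\<^sup>T)"
    unfolding algorithm_iff by blast
  have "galerkin (V1_space x y m r E) fK" "galerkin (V2_space x y n r U) fL"
      "galerkin (V0_space x y r (QU K) (QE L)) fS"
    using steps unfolding f galerkin_K[OF K] galerkin_L[OF L] galerkin_S[OF K L T] .
  then show ?scheme
    unfolding scheme_solution_def Let_def using K L f by blast
qed

lemma algorithm_unique:
  "\<exists>!(K, L, T). algorithm_solution \<epsilon>max \<eta> chi m n r x y QU QE dt U S E K L T"
proof -
  obtain K where K: "K \<in> carrier_mat m r" "K_step K"
    and K_unique: "\<And>K'. K' \<in> carrier_mat m r \<Longrightarrow> K_step K' \<Longrightarrow> K' = K"
    using K_step_unique by blast
  obtain L where L: "L \<in> carrier_mat n r" "L_step L"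
    and L_unique: "\<And>L'. L' \<in> carrier_mat n r \<Longrightarrow> L_step L' \<Longrightarrow> L' = L"
    using L_step_unique by blast
  obtain T where T: "T \<in> carrier_mat r r" "S_step (QU K) (QE L) T"
    and T_unique: "\<And>T'. T' \<in> carrier_mat r r \<Longrightarrow> S_step (QU K) (QE L) T' \<Longrightarrow> T' = T"
    using S_step_unique[OF K(1) L(1)] by blast
  show ?thesis
  proof (rule ex1I[of _ "(K, L, T)"])
    show "case (K, L, T) of (K, L, T) \<Rightarrow>
        algorithm_solution \<epsilon>max \<eta> chi m n r x y QU QE dt U S E K L T"
      unfolding prod.case algorithm_iff using K L T by blast
  next
    fix sol
    assume "case sol of (K, L, T) \<Rightarrow>
        algorithm_solution \<epsilon>max \<eta> chi m n r x y QU QE dt U S E K L T"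
    moreover obtain K' L' T' where sol: "sol = (K', L', T')" by (cases sol)
    ultimately have "K' \<in> carrier_mat m r" "K_step K'" "L' \<in> carrier_mat n r" "L_step L'"
      "T' \<in> carrier_mat r r" "S_step (QU K') (QE L') T'"
      unfolding sol prod.case algorithm_iff by blast+
    moreover from this have "K' = K" "L' = L"
      using K_unique L_unique by blast+
    ultimately show "sol = (K, L, T)"
      unfolding sol using T_unique by blast
  qed
qed

text \<open>Uniqueness of the functions follows from that of the matrices: every solution of the scheme is
  represented by a solution of the algorithm.\<close>

lemma scheme_unique:
  "\<exists>!(fK, fL, fS). scheme_solution \<epsilon>max \<eta> chi m n r x y QU QE dt U S E fK fL fS"
proof -
  obtain K L T where sol: "algorithm_solution \<epsilon>max \<eta> chi m n r x y QU QE dt U S E K L T"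
    and unique: "\<And>K' L' T'. algorithm_solution \<epsilon>max \<eta> chi m n r x y QU QE dt U S E K' L' T'
      \<Longrightarrow> K' = K \<and> L' = L \<and> T' = T"
    using algorithm_unique unfolding Ex1_def split_paired_Ex split_paired_All prod.case prod.inject
    by blast
  let ?f = "(mat_fun x y (K * E\<^sup>T), mat_fun x y (U * L\<^sup>T), mat_fun x y (QU K * T * (QE L)\<^sup>T))"
  show ?thesis
  proof (rule ex1I[of _ ?f])
    show "case ?f of (fK, fL, fS) \<Rightarrow>
        scheme_solution \<epsilon>max \<eta> chi m n r x y QU QE dt U S E fK fL fS"
      unfolding prod.case scheme_iff using sol by blast
  next
    fix f
    assume f: "case f of (fK, fL, fS) \<Rightarrow>
        scheme_solution \<epsilon>max \<eta> chi m n r x y QU QE dt U S E fK fL fS"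
    obtain fK fL fS where f_eq: "f = (fK, fL, fS)" by (cases f)
    from f obtain K' L' T' where "algorithm_solution \<epsilon>max \<eta> chi m n r x y QU QE dt U S E K' L' T'"
      and f': "fK = mat_fun x y (K' * E\<^sup>T)" "fL = mat_fun x y (U * L'\<^sup>T)"
        "fS = mat_fun x y (QU K' * T' * (QE L')\<^sup>T)"
      unfolding f_eq prod.case scheme_iff by blast
    then have "K' = K" "L' = L" "T' = T" using unique by blast+
    then show "f = ?f" by (simp only: f_eq f')
  qed
qed

text \<open>In the direction from the scheme to the algorithm, \<open>fS\<close> belongs to the space built from some
  representing matrices \<open>K'\<close> and \<open>L'\<close>. Unique solvability of the first two equations identifies
  them with \<open>K\<close> and \<open>L\<close>, so the space is the one built from \<open>QU K\<close> and \<open>QE L\<close>.\<close>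

lemma algorithm_iff_scheme:
  assumes K: "K \<in> carrier_mat m r" and L: "L \<in> carrier_mat n r" and T: "T \<in> carrier_mat r r"
  shows "algorithm_solution \<epsilon>max \<eta> chi m n r x y QU QE dt U S E K L T \<longleftrightarrow>
    scheme_solution \<epsilon>max \<eta> chi m n r x y QU QE dt U S E
      (mat_fun x y (K * E\<^sup>T)) (mat_fun x y (U * L\<^sup>T)) (mat_fun x y (QU K * T * (QE L)\<^sup>T))"
    (is "_ \<longleftrightarrow> ?scheme")
proof
  assume scheme: ?scheme
  then obtain K' L' T' where sol': "algorithm_solution \<epsilon>max \<eta> chi m n r x y QU QE dt U S E K' L' T'"
    and fS: "mat_fun x y (QU K * T * (QE L)\<^sup>T) = mat_fun x y (QU K' * T' * (QE L')\<^sup>T)"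
    unfolding scheme_iff by blast
  have "K_step K" "L_step L"
    using scheme galerkin_K[OF K] galerkin_L[OF L] by (auto simp: scheme_solution_def Let_def)
  then have "K' = K" "L' = L"
    using sol' K L K_step_unique L_step_unique unfolding algorithm_iff by blast+
  moreover have "S_step (QU K) (QE L) T"
  proof -
    have T': "T' \<in> carrier_mat r r" "S_step (QU K) (QE L) T'"
      using sol' \<open>K' = K\<close> \<open>L' = L\<close> by (simp_all add: algorithm_iff)
    have "mat_fun x y (QU K * T * (QE L)\<^sup>T) = mat_fun x y (QU K * T' * (QE L)\<^sup>T)"
      using fS \<open>K' = K\<close> \<open>L' = L\<close> by simp
    then show ?thesis
      using galerkin_S[OF K L T] galerkin_S[OF K L T'(1)] T'(2) by simp
  qed
  ultimately show "algorithm_solution \<epsilon>max \<eta> chi m n r x y QU QE dt U S E K L T"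
    using sol' T unfolding algorithm_iff by simp
qed (auto simp: scheme_iff)

end

theorem lemma4p3:
  fixes \<epsilon>max chimin chimax dt :: real
    and \<eta> chi :: "real \<Rightarrow> real"
    and p\<mu> p\<epsilon> :: "nat \<Rightarrow> real"
    and N\<mu> N\<epsilon> k m n r :: nat
    and x y :: "nat \<Rightarrow> real \<Rightarrow> real"
    and QU QE :: "real mat \<Rightarrow> real mat"
    and U S E :: "real mat"
  assumes "\<epsilon>max > 0"
    and "set_borel_measurable lebesgue {0..\<epsilon>max} \<eta>"
    and "\<And>\<epsilon>. \<epsilon> \<in> {0..\<epsilon>max} \<Longrightarrow> \<eta> \<epsilon> > 0"
    and "set_integrable lebesgue {0..\<epsilon>max} (\<lambda>\<epsilon>. (\<eta> \<epsilon>)\<^sup>2 * \<epsilon>\<^sup>2)"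
    and "set_borel_measurable lebesgue {0..\<epsilon>max} chi"
    and "0 < chimin"
    and "\<And>\<epsilon>. \<epsilon> \<in> {0..\<epsilon>max} \<Longrightarrow> chimin \<le> chi \<epsilon> \<and> chi \<epsilon> \<le> chimax"
    and "interval_partition (-1) 1 N\<mu> p\<mu>"
    and "interval_partition 0 \<epsilon>max N\<epsilon> p\<epsilon>"
    and "m = (k + 1) * N\<mu>"
    and "n = (k + 1) * N\<epsilon>"
    and "1 \<le> r" and "r \<le> min m n"
    and "legendre_basis p\<mu> N\<mu> k x"
    and "legendre_basis p\<epsilon> N\<epsilon> k y"
    and "U \<in> carrier_mat m r" and "S \<in> carrier_mat r r" and "E \<in> carrier_mat n r"
    and "U\<^sup>T * U = 1\<^sub>m r"
    and "E\<^sup>T * mass_mat \<epsilon>max (\<lambda>_. 1) n y * E = 1\<^sub>m r"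
    and "\<And>K. K \<in> carrier_mat m r \<Longrightarrow> qr_factor (1\<^sub>m m) m r K (QU K)"
    and "\<And>L. L \<in> carrier_mat n r \<Longrightarrow> qr_factor (mass_mat \<epsilon>max (\<lambda>_. 1) n y) n r L (QE L)"
    and "dt > 0"
  shows "(\<exists>!sol. case sol of (fK, fL, fS) \<Rightarrow>
            scheme_solution \<epsilon>max \<eta> chi m n r x y QU QE dt U S E fK fL fS)
    \<and> (\<exists>!sol. case sol of (K1, L1, S1) \<Rightarrow>
            algorithm_solution \<epsilon>max \<eta> chi m n r x y QU QE dt U S E K1 L1 S1)
    \<and> (\<forall>K1\<in>carrier_mat m r. \<forall>L1\<in>carrier_mat n r. \<forall>S1\<in>carrier_mat r r.
          algorithm_solution \<epsilon>max \<eta> chi m n r x y QU QE dt U S E K1 L1 S1 \<longleftrightarrow>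
          scheme_solution \<epsilon>max \<eta> chi m n r x y QU QE dt U S E
            (mat_fun x y (K1 * E\<^sup>T)) (mat_fun x y (U * L1\<^sup>T))
            (mat_fun x y (QU K1 * S1 * (QE L1)\<^sup>T)))"
proof -
  interpret low_rank_step \<epsilon>max chimin chimax dt \<eta> chi m n x y r U S E QU QE
  proof unfold_locales
    show "bounded_orthonormal (-1) 1 m x" "bounded_orthonormal 0 \<epsilon>max n y"
      using assms legendre_basis_bounded_orthonormal by auto
  qed (use assms in auto)
  show ?thesis
    using scheme_unique algorithm_unique algorithm_iff_scheme by blast
qed

end
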